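(* Let $\mu$ be a Borel measure on $\mathbb{R}^d$. Let $E$ be a Banach space and let $1\le p<\infty$. Let $\mathcal{S}$ be a sparse collection of dyadic cubes. For each $S\in\mathcal{S}$, assume that $f_S:\mathbb{R}^d\to E$ is a function that is supported on $S$ and constant on each $S'\in\mathrm{ch}_{\mathcal{S}}(S)$. Then $$\Big\|\sum_{S\in\mathcal{S}}f_S\Big\|_{L^p(\mu;E)}\le3p\Big(\sum_{S\in\mathcal{S}}\|f_S\|_{L^p(\mu;E)}^p\Big)^{1/p}.$$ Moreover, the reverse estimate $$\Big(\sum_{S\in\mathcal{S}}\|f_S\|_{L^p(\mu;E)}^p\Big)^{1/p}\le6p'\,\Big\|\sum_{S\in\mathcal{S}}f_S\Big\|_{L^p(\mu;E)}$$ holds if, in addition, one of the following conditions is satisfied: (i) $\int_Sf_S\,d\mu=0$ (for every $S\in\mathcal{S}$), or (ii) $E=\mathbb{R}$ and $f_S\ge0$ (for every $S\in\mathcal{S}$); but it may in general fail otherwise.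
   Context: $p'$ is the conjugate exponent of $p$, $\frac1p+\frac1{p'}=1$. For a collection $\mathcal{S}$ of dyadic cubes and $S\in\mathcal{S}$, $\mathrm{ch}_{\mathcal{S}}(S)$ is the collection of all maximal $S'\in\mathcal{S}$ with $S'\subsetneq S$, and $E_{\mathcal{S}}(S)=S\setminus\bigcup_{S'\in\mathrm{ch}_{\mathcal{S}}(S)}S'$. The collection $\mathcal{S}$ is sparse if $\mu(E_{\mathcal{S}}(S))\ge\frac12\mu(S)$ for every $S\in\mathcal{S}$. *)

theory Defs
  imports "HOL-Analysis.Analysis"
begin

definition dyadic_cube :: "int \<Rightarrow> ('n \<Rightarrow> int) \<Rightarrow> (real^'n::finite) set" where
  "dyadic_cube k m =
     {x. \<forall>i. 2 powi (- k) * of_int (m i) \<le> x $ i \<and> x $ i < 2 powi (- k) * of_int (m i + 1)}"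

definition dyadic_cubes :: "(real^'n::finite) set set" where
  "dyadic_cubes = {dyadic_cube k m | k m. True}"

definition ch :: "'a set set \<Rightarrow> 'a set \<Rightarrow> 'a set set" where
  "ch \<S> S = {S' \<in> \<S>. S' \<subset> S \<and> (\<forall>T\<in>\<S>. T \<subset> S \<longrightarrow> S' \<subseteq> T \<longrightarrow> T = S')}"

definition E_part :: "'a set set \<Rightarrow> 'a set \<Rightarrow> 'a set" where
  "E_part \<S> S = S - \<Union>(ch \<S> S)"

definition sparse_collection :: "'a measure \<Rightarrow> 'a set set \<Rightarrow> bool" where
  "sparse_collection \<mu> \<S> \<longleftrightarrow> (\<forall>S\<in>\<S>. emeasure \<mu> S / 2 \<le> emeasure \<mu> (E_part \<S> S))"

text \<open>
  The library's Bochner integral is restricted to second countable (that is, separable) value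
  spaces. For an arbitrary Banach space Borel measurability is replaced by strong measurability;
  the definition of the integral is otherwise that of \<^const>\<open>has_bochner_integral\<close>.
\<close>

definition strongly_measurable :: "'a measure \<Rightarrow> ('a \<Rightarrow> 'b::real_normed_vector) \<Rightarrow> bool" where
  "strongly_measurable M f \<longleftrightarrow>
     (\<exists>s. (\<forall>i. simple_function M (s i)) \<and> (\<forall>x\<in>space M. (\<lambda>i. s i x) \<longlonglongrightarrow> f x))"

definition has_strong_integral ::
    "'a measure \<Rightarrow> ('a \<Rightarrow> 'b::real_normed_vector) \<Rightarrow> 'b \<Rightarrow> bool" where
  "has_strong_integral M f y \<longleftrightarrow>
     strongly_measurable M f \<and>
     (\<exists>s. (\<forall>i. Bochner_Integration.simple_bochner_integrable M (s i)) \<and>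
          (\<lambda>i. \<integral>\<^sup>+x. ennreal (norm (f x - s i x)) \<partial>M) \<longlonglongrightarrow> 0 \<and>
          (\<lambda>i. Bochner_Integration.simple_bochner_integral M (s i)) \<longlonglongrightarrow> y)"

text \<open>Powers of elements of \<open>[0,\<infinity>]\<close>, meant for exponents \<open>a > 0\<close> only.\<close>

definition epowr :: "ennreal \<Rightarrow> real \<Rightarrow> ennreal" where
  "epowr x a = (if x = \<infinity> then \<infinity> else ennreal (enn2real x powr a))"

definition Lp_norm :: "'a measure \<Rightarrow> real \<Rightarrow> ('a \<Rightarrow> 'b::real_normed_vector) \<Rightarrow> ennreal" where
  "Lp_norm M p f = epowr (\<integral>\<^sup>+x. ennreal (norm (f x) powr p) \<partial>M) (1 / p)"

definition lp_Lp_norm ::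
    "'a measure \<Rightarrow> real \<Rightarrow> 'i set \<Rightarrow> ('i \<Rightarrow> 'a \<Rightarrow> 'b::real_normed_vector) \<Rightarrow> ennreal" where
  "lp_Lp_norm M p I f = epowr (\<Sum>\<^sub>\<infinity>i\<in>I. epowr (Lp_norm M p (f i)) p) (1 / p)"

text \<open>
  The series \<open>\<Sum>\<^sub>i f\<^sub>i\<close> is understood as an unconditionally convergent series in
  \<open>L\<^sup>p(M;E)\<close>: its finite partial sums converge to \<open>g\<close> in norm. Almost everywhere pointwise
  convergence would be too weak an interpretation for the reverse estimate: the differences
  of the martingale \<open>2\<^sup>k 1\<^bsub>[0,2^(-k))\<^esub>\<close> have mean zero and sum to \<open>-1\<close> almost everywhere
  on \<open>[0,1)\<close>, while the \<open>p\<close>-th powers of their norms do not have a finite sum.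
\<close>

definition Lp_has_sum ::
    "'a measure \<Rightarrow> real \<Rightarrow> 'i set \<Rightarrow> ('i \<Rightarrow> 'a \<Rightarrow> 'b::real_normed_vector) \<Rightarrow> ('a \<Rightarrow> 'b) \<Rightarrow> bool" where
  "Lp_has_sum M p I f g \<longleftrightarrow>
     strongly_measurable M g \<and>
     ((\<lambda>F. Lp_norm M p (\<lambda>x. (\<Sum>i\<in>F. f i x) - g x)) \<longlongrightarrow> 0) (finite_subsets_at_top I)"

text \<open>The exponent \<open>p'\<close> lies in \<open>[1,\<infinity>]\<close>, and it is \<open>\<infinity>\<close> for \<open>p = 1\<close>.\<close>

definition conj_exponent :: "real \<Rightarrow> ennreal" where
  "conj_exponent p = inverse (1 - inverse (ennreal p))"

lemma conj_exponent:
  assumes "1 \<le> p"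
  shows "inverse (ennreal p) + inverse (conj_exponent p) = 1"
proof (cases "p = 1")
  case True
  then show ?thesis by (simp add: conj_exponent_def)
next
  case False
  then have p: "1 < p" using assms by simp
  then have "conj_exponent p = inverse (ennreal (1 - 1 / p))"
    by (simp add: conj_exponent_def inverse_ennreal inverse_eq_divide ennreal_minus flip: ennreal_1)
  also have "inverse \<dots> = ennreal (1 - 1 / p)"
    using p by (simp add: inverse_ennreal)
  finally show ?thesis
    using p by (simp add: inverse_ennreal inverse_eq_divide flip: ennreal_plus)
qed

definition adapted ::
    "'a measure \<Rightarrow> 'a set set \<Rightarrow> ('a set \<Rightarrow> 'a \<Rightarrow> 'b::real_normed_vector) \<Rightarrow> bool" where
  "adapted \<mu> \<S> f \<longleftrightarrow>
     (\<forall>S\<in>\<S>. strongly_measurable \<mu> (f S) \<and>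
             (\<forall>x. x \<notin> S \<longrightarrow> f S x = 0) \<and>
             (\<forall>S'\<in>ch \<S> S. f S constant_on S'))"

end

theory Submission
  imports Defs
begin

text \<open>
  Let \<open>a\<^sub>S \<ge> 0\<close>, \<open>F = \<Sum>\<^sub>S a\<^sub>S 1\<^sub>S\<close> and \<open>B\<^sub>S = \<Sum>\<^bsub>R \<supseteq> S\<^esub> a\<^sub>R\<close>. The cubes containing a point form a chain, so telescoping along it
  gives the pointwise bound \<open>F\<^sup>q \<le> q \<Sum>\<^sub>S a\<^sub>S B\<^sub>S\<^bsup>q - 1\<^esup> 1\<^sub>S\<close>. Since \<open>F \<ge> B\<^sub>S\<close> on the pairwise disjoint sets
  \<open>E(S)\<close>, sparseness yields \<open>\<Sum>\<^sub>S B\<^sub>S\<^sup>q \<mu>(S) \<le> 2 \<integral>F\<^sup>q\<close>, and Young's inequality absorbs this into the left-hand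
  side: \<open>\<integral>F\<^sup>q \<le> 2\<^bsup>q - 1\<^esup> q\<^sup>q \<Sum>\<^sub>S a\<^sub>S\<^sup>q \<mu>(S)\<close>. Splitting each \<open>f\<^sub>S\<close> into its part on \<open>E(S)\<close> and its constant
  values on the children of \<open>S\<close> turns this into the first estimate for finite collections.

  If the \<open>f\<^sub>S\<close> have mean zero, then \<open>u\<^sub>S\<close>, the value on \<open>S\<close> of \<open>\<Sum>\<^bsub>R \<supset> S\<^esub> f\<^sub>R\<close>, is the average over \<open>S\<close> of
  \<open>h = \<Sum>\<^sub>R f\<^sub>R\<close>; moreover \<open>f\<^sub>S = h - u\<^sub>S\<close> on \<open>E(S)\<close> and \<open>f\<^sub>S = u\<^sub>T - u\<^sub>S\<close> on a child \<open>T\<close>. The reverse estimate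
  follows from the Carleson embedding \<open>\<Sum>\<^sub>S |u\<^sub>S|\<^sup>p \<mu>(S) \<le> 2 p'\<^sup>p \<integral>|h|\<^sup>p\<close>, which is dual to the estimate above.
  The constants do not depend on the collection, so both estimates pass to infinite sums.
\<close>

section \<open>Inequalities for real powers\<close>

text \<open>Convexity: the graph of the power lies above its tangent at \<open>x\<close>. The
  derivative argument runs on the open half-line, so \<open>x = 0\<close> and \<open>y = 0\<close>
  are treated apart; at \<open>x = 0\<close> the convention \<open>0 powr (q - 1) = 0\<close>, valid
  also for \<open>q = 1\<close>, keeps the inequality true.\<close>

lemma powr_tangent:
  fixes x y q :: real
  assumes q: "1 \<le> q" and x: "0 \<le> x" and y: "0 \<le> y"
  shows "x powr q + q * x powr (q - 1) * (y - x) \<le> y powr q"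
proof (cases "x = 0 \<or> y = 0")
  case True
  then show ?thesis
  proof
    assume "x = 0"
    then show ?thesis by simp
  next
    assume y0: "y = 0"
    have "x powr (q - 1) * x = x powr q"
      using x by (cases "x = 0") (simp_all add: powr_diff)
    then have "x powr q + q * x powr (q - 1) * (y - x) = (1 - q) * x powr q"
      by (simp add: y0 algebra_simps)
    also have "\<dots> \<le> 0" using q by (simp add: mult_le_0_iff)
    also have "\<dots> \<le> y powr q" by simp
    finally show ?thesis .
  qed
next
  case False
  then have x: "0 < x" and y: "0 < y" using assms by auto
  have "q * x powr (q - 1) * (y - x) \<le> y powr q - x powr q"
  proof (rule convex_on_imp_above_tangent[where A = "{0<..}" and f = "\<lambda>x. x powr q"])
    show "convex_on {0<..} (\<lambda>x::real. x powr q)" using powr_convex[OF q] .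
    show "((\<lambda>x. x powr q) has_real_derivative q * x powr (q - 1)) (at x within {0<..})"
      using x by (auto intro!: derivative_eq_intros)
  qed (use x y in \<open>auto simp: interior_open connected_iff_interval\<close>)
  then show ?thesis by simp
qed

text \<open>Convexity of the power at the combination \<open>(1 - \<theta>) * (a / (1 - \<theta>)) +
  \<theta> * (b / \<theta>)\<close> of value \<open>a + b\<close>. The weight stays free:
  Minkowski's inequality takes it proportional to the two norms, the first estimate takes
  \<open>2 / 3\<close>.\<close>

lemma powr_add_weighted_le:
  fixes a b p \<theta> :: real
  assumes p: "1 \<le> p" and a: "0 \<le> a" and b: "0 \<le> b" and \<theta>: "0 < \<theta>" "\<theta> < 1"
  shows "(a + b) powr p \<le> (1 - \<theta>) powr (1 - p) * a powr p + \<theta> powr (1 - p) * b powr p"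
proof -
  let ?s = "a + b" and ?a = "a / (1 - \<theta>)" and ?b = "b / \<theta>"
  have "?s powr p + p * ?s powr (p - 1) * (?a - ?s) \<le> ?a powr p"
       "?s powr p + p * ?s powr (p - 1) * (?b - ?s) \<le> ?b powr p"
    using assms by (auto intro!: powr_tangent)
  then have "(1 - \<theta>) * (?s powr p + p * ?s powr (p - 1) * (?a - ?s))
      + \<theta> * (?s powr p + p * ?s powr (p - 1) * (?b - ?s)) \<le> (1 - \<theta>) * ?a powr p + \<theta> * ?b powr p"
    using \<theta> by (intro add_mono mult_left_mono) auto
  moreover have "(1 - \<theta>) * (?s powr p + p * ?s powr (p - 1) * (?a - ?s))
      + \<theta> * (?s powr p + p * ?s powr (p - 1) * (?b - ?s))
      = ?s powr p + p * ?s powr (p - 1) * (((1 - \<theta>) * ?a + \<theta> * ?b) - ?s)"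
    by (simp only: algebra_simps)
  moreover have "(1 - \<theta>) * ?a + \<theta> * ?b = ?s" using \<theta> by simp
  moreover have "(1 - \<theta>) * ?a powr p = (1 - \<theta>) powr (1 - p) * a powr p"
    using \<theta> a by (simp add: powr_divide powr_diff)
  moreover have "\<theta> * ?b powr p = \<theta> powr (1 - p) * b powr p"
    using \<theta> b by (simp add: powr_divide powr_diff)
  ultimately show ?thesis by simp
qed

text \<open>Each \<open>c\<close> between 0 and \<open>a + b\<close> satisfies
  \<open>c powr p \<le> c * (a + b) powr (p - 1)\<close>; the claim is the sum of the cases
  \<open>c = a\<close> and \<open>c = b\<close>.\<close>

lemma powr_add_powr_le:
  fixes a b p :: real
  assumes "1 \<le> p" and "0 \<le> a" and "0 \<le> b"
  shows "a powr p + b powr p \<le> (a + b) powr p"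
proof (cases "a + b = 0")
  case False
  then have s: "0 < a + b" using assms by simp
  have *: "c powr p \<le> c * (a + b) powr (p - 1)" if "0 \<le> c" "c \<le> a + b" for c
  proof (cases "c = 0")
    case False
    then have "c powr p = c * c powr (p - 1)" using that by (simp add: powr_diff)
    also have "\<dots> \<le> c * (a + b) powr (p - 1)"
      using that assms by (intro mult_left_mono powr_mono2) auto
    finally show ?thesis .
  qed simp
  have "a powr p + b powr p \<le> (a + b) * (a + b) powr (p - 1)"
    using *[of a] *[of b] assms by (simp add: distrib_right)
  then show ?thesis using s by (simp add: powr_diff)
qed (use assms in \<open>auto simp: add_nonneg_eq_0_iff\<close>)

lemma sum_powr_le_powr_sum:
  fixes b :: "'i \<Rightarrow> real"
  assumes p: "1 \<le> p" and "\<And>i. i \<in> A \<Longrightarrow> 0 \<le> b i"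
  shows "(\<Sum>i\<in>A. b i powr p) \<le> (\<Sum>i\<in>A. b i) powr p"
  using assms(2)
proof (induction A rule: infinite_finite_induct)
  case (insert i A)
  have "(\<Sum>i\<in>insert i A. b i powr p) \<le> b i powr p + (\<Sum>i\<in>A. b i) powr p"
    using insert by simp
  also have "\<dots> \<le> (\<Sum>i\<in>insert i A. b i) powr p"
    using insert by (simp add: powr_add_powr_le p sum_nonneg)
  finally show ?case .
qed auto

text \<open>At most one summand is nonzero. This applies to functions with pairwise disjoint
  supports, and to sums over the parents of a cube, of which there is at most one.\<close>

lemma sum_powr_eq_powr_sum:
  fixes b :: "'i \<Rightarrow> real"
  assumes A: "finite A" and single: "\<And>i j. i \<in> A \<Longrightarrow> j \<in> A \<Longrightarrow> b i \<noteq> 0 \<Longrightarrow> b j \<noteq> 0 \<Longrightarrow> i = j"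
  shows "(\<Sum>i\<in>A. b i) powr p = (\<Sum>i\<in>A. b i powr p)"
proof (cases "\<exists>i\<in>A. b i \<noteq> 0")
  case True
  then obtain i where i: "i \<in> A" "b i \<noteq> 0" by auto
  then have *: "b j = 0" if "j \<in> A - {i}" for j using single that by blast
  have "(\<Sum>i\<in>A. b i) = b i" using A i * by (simp add: sum.remove)
  moreover have "(\<Sum>i\<in>A. b i powr p) = b i powr p" using A i * by (simp add: sum.remove)
  ultimately show ?thesis by simp
qed simp

text \<open>Removing the smallest set \<open>T\<close> lowers the full sum \<open>s\<close> by
  \<open>a T\<close>, and the tangent at \<open>s\<close> bounds the loss in \<open>s powr q\<close>
  by \<open>q * a T * s powr (q - 1)\<close>. All members contain \<open>T\<close>, so its inner sum
  is \<open>s\<close>; the inner sums of the other members do not involve \<open>T\<close>, so the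
  induction hypothesis applies unchanged.\<close>

lemma powr_chain_sum_le:
  fixes a :: "'a set \<Rightarrow> real"
  assumes q: "1 \<le> q" and "finite G" and "\<And>S. S \<in> G \<Longrightarrow> 0 \<le> a S"
    and "\<And>S T. S \<in> G \<Longrightarrow> T \<in> G \<Longrightarrow> S \<subseteq> T \<or> T \<subseteq> S"
  shows "(\<Sum>S\<in>G. a S) powr q \<le> (\<Sum>S\<in>G. q * a S * (\<Sum>R\<in>{R\<in>G. S \<subseteq> R}. a R) powr (q - 1))"
  using assms(2-)
proof (induction G rule: finite_psubset_induct)
  case (psubset G)
  show ?case
  proof (cases "G = {}")
    case False
    obtain T where T: "T \<in> G" "\<And>R. R \<in> G \<Longrightarrow> R \<subseteq> T \<Longrightarrow> R = T"
      using finite_has_minimal[OF psubset.hyps(1) False] by auto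
    have sub: "T \<subseteq> R" if "R \<in> G" for R using T psubset.prems(2) that by blast
    let ?G = "G - {T}"
    let ?s = "\<Sum>S\<in>G. a S" and ?t = "\<Sum>S\<in>?G. a S"
    have IH: "?t powr q \<le> (\<Sum>S\<in>?G. q * a S * (\<Sum>R\<in>{R\<in>?G. S \<subseteq> R}. a R) powr (q - 1))"
      by (rule psubset.IH) (use T psubset.prems in auto)
    have eq: "{R\<in>?G. S \<subseteq> R} = {R\<in>G. S \<subseteq> R}" if "S \<in> ?G" for S
      using that sub by auto
    have G: "{R\<in>G. T \<subseteq> R} = G" using sub by auto
    have s: "?s = a T + ?t" using T psubset.hyps by (simp add: sum.remove)
    have nn: "0 \<le> ?s" "0 \<le> ?t" using psubset.prems(1) by (auto intro!: sum_nonneg)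
    have "?s powr q - q * ?s powr (q - 1) * a T \<le> ?t powr q"
      using powr_tangent[OF q nn] by (simp add: s algebra_simps)
    then have "?s powr q \<le> q * a T * ?s powr (q - 1) + ?t powr q" by (simp add: algebra_simps)
    also note IH
    also have "(\<Sum>S\<in>?G. q * a S * (\<Sum>R\<in>{R\<in>?G. S \<subseteq> R}. a R) powr (q - 1))
        = (\<Sum>S\<in>?G. q * a S * (\<Sum>R\<in>{R\<in>G. S \<subseteq> R}. a R) powr (q - 1))"
      by (intro sum.cong refl) (simp only: eq)
    finally show ?thesis
      using T psubset.hyps G
      by (simp add: sum.remove[where x = T and g = "\<lambda>S. q * a S * (\<Sum>R\<in>{R\<in>G. S \<subseteq> R}. a R) powr (q - 1)"])
  qed (use q in simp)
qed

text \<open>The weights make the second term absorbable: after integration it becomes \<open>(q - 1) / q\<close> times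
  the quantity being estimated.\<close>

lemma Young_chain:
  fixes a b q :: real
  assumes q: "1 \<le> q" and a: "0 \<le> a" and b: "0 \<le> b"
  shows "q * a * b powr (q - 1) \<le> (2 * q) powr (q - 1) * a powr q + (q - 1) / (2 * q) * b powr q"
proof -
  have "b powr (q - 1) * b = b powr q"
    using b by (cases "b = 0") (simp_all add: powr_diff)
  \<comment> \<open>This is the tangent at \<open>b\<close> evaluated at \<open>2 * q * a\<close>;
    division by \<open>2 * q\<close> yields the claim.\<close>
  then have "b powr q + q * b powr (q - 1) * (2 * q * a - b)
      = 2 * q * (q * a * b powr (q - 1)) - (q - 1) * b powr q"
    by (simp add: algebra_simps)
  moreover have "(2 * q * a) powr q = 2 * q * ((2 * q) powr (q - 1) * a powr q)"
    using q a by (simp add: powr_mult powr_diff)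
  ultimately have "2 * q * (q * a * b powr (q - 1))
      \<le> 2 * q * ((2 * q) powr (q - 1) * a powr q) + (q - 1) * b powr q"
    using powr_tangent[OF q b, of "2 * q * a"] q a by simp
  also have "\<dots> = 2 * q * ((2 * q) powr (q - 1) * a powr q + (q - 1) / (2 * q) * b powr q)"
    using q by (simp add: field_simps)
  finally show ?thesis using q by simp
qed

text \<open>The tangents at \<open>s = a + b + c\<close> are evaluated at \<open>3 * a\<close>,
  \<open>3 * b\<close> and \<open>3 * c\<close>, whose mean is \<open>s\<close>, so the linear terms
  cancel on summation.\<close>

lemma powr_add3_le:
  fixes a b c p :: real
  assumes p: "1 \<le> p" and a: "0 \<le> a" and b: "0 \<le> b" and c: "0 \<le> c"
  shows "(a + b + c) powr p \<le> 3 powr (p - 1) * (a powr p + b powr p + c powr p)"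
proof -
  let ?s = "a + b + c"
  have t: "?s powr p + p * ?s powr (p - 1) * (3 * x - ?s) \<le> 3 powr p * x powr p" if "0 \<le> x" for x
    using powr_tangent[OF p, of ?s "3 * x"] assms that by (simp add: powr_mult)
  have "3 * ?s powr p = (?s powr p + p * ?s powr (p - 1) * (3 * a - ?s))
      + (?s powr p + p * ?s powr (p - 1) * (3 * b - ?s))
      + (?s powr p + p * ?s powr (p - 1) * (3 * c - ?s))"
    by (simp add: algebra_simps)
  also have "\<dots> \<le> 3 powr p * (a powr p + b powr p + c powr p)"
    using t[OF a] t[OF b] t[OF c] by (simp add: algebra_simps)
  finally show ?thesis by (simp add: powr_diff field_simps)
qed

section \<open>Strong measurability and mean zero\<close>

lemma strongly_measurable_const [simp]: "strongly_measurable M (\<lambda>x. c)"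
  unfolding strongly_measurable_def by (intro exI[of _ "\<lambda>i x. c"]) simp

lemma strongly_measurable_add:
  assumes "strongly_measurable M f" and "strongly_measurable M g"
  shows "strongly_measurable M (\<lambda>x. f x + g x)"
proof -
  obtain s t where "\<And>i. simple_function M (s i)" "\<And>x. x \<in> space M \<Longrightarrow> (\<lambda>i. s i x) \<longlonglongrightarrow> f x"
    "\<And>i. simple_function M (t i)" "\<And>x. x \<in> space M \<Longrightarrow> (\<lambda>i. t i x) \<longlonglongrightarrow> g x"
    using assms unfolding strongly_measurable_def by metis
  then show ?thesis
    unfolding strongly_measurable_def
    by (intro exI[of _ "\<lambda>i x. s i x + t i x"]) (auto intro: tendsto_add simple_function_add)
qed

lemma strongly_measurable_diff:
  assumes "strongly_measurable M f" and "strongly_measurable M g"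
  shows "strongly_measurable M (\<lambda>x. f x - g x)"
proof -
  obtain s t where "\<And>i. simple_function M (s i)" "\<And>x. x \<in> space M \<Longrightarrow> (\<lambda>i. s i x) \<longlonglongrightarrow> f x"
    "\<And>i. simple_function M (t i)" "\<And>x. x \<in> space M \<Longrightarrow> (\<lambda>i. t i x) \<longlonglongrightarrow> g x"
    using assms unfolding strongly_measurable_def by metis
  then show ?thesis
    unfolding strongly_measurable_def
    by (intro exI[of _ "\<lambda>i x. s i x - t i x"]) (auto intro: tendsto_diff simple_function_diff)
qed

lemma strongly_measurable_sum:
  assumes "\<And>i. i \<in> I \<Longrightarrow> strongly_measurable M (f i)"
  shows "strongly_measurable M (\<lambda>x. \<Sum>i\<in>I. f i x)"
  using assms
  by (induction I rule: infinite_finite_induct) (auto intro: strongly_measurable_add)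

lemma strongly_measurable_indicator_scaleR:
  assumes "A \<in> sets M" and "strongly_measurable M f"
  shows "strongly_measurable M (\<lambda>x. indicator A x *\<^sub>R f x)"
proof -
  obtain s where "\<And>i. simple_function M (s i)" "\<And>x. x \<in> space M \<Longrightarrow> (\<lambda>i. s i x) \<longlonglongrightarrow> f x"
    using assms(2) unfolding strongly_measurable_def by metis
  moreover have "simple_function M (indicator A :: _ \<Rightarrow> real)"
    using assms(1) by (rule simple_function_indicator)
  ultimately show ?thesis
    unfolding strongly_measurable_def
    by (intro exI[of _ "\<lambda>i x. indicator A x *\<^sub>R s i x"])
      (auto intro: tendsto_scaleR simple_function_compose2[where h = "(*\<^sub>R)"])
qed

lemma borel_measurable_norm_strongly_measurable:
  assumes "strongly_measurable M f"
  shows "(\<lambda>x. norm (f x)) \<in> borel_measurable M"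
proof -
  obtain s where s: "\<And>i. simple_function M (s i)" "\<And>x. x \<in> space M \<Longrightarrow> (\<lambda>i. s i x) \<longlonglongrightarrow> f x"
    using assms unfolding strongly_measurable_def by metis
  show ?thesis
  proof (rule borel_measurable_LIMSEQ_real[where u = "\<lambda>i x. norm (s i x)"])
    show "(\<lambda>x. norm (s i x)) \<in> borel_measurable M" for i
      using simple_function_compose1[OF s(1)] by (rule borel_measurable_simple_function)
  qed (use s(2) in \<open>auto intro: tendsto_norm\<close>)
qed

text \<open>All approximating simple functions together take only countably many values; the limit is
  approximated by the nearest among the first \<open>n\<close> of them.\<close>

lemma strongly_measurable_LIMSEQ:
  fixes f :: "nat \<Rightarrow> 'a \<Rightarrow> 'b::real_normed_vector"
  assumes f: "\<And>n. strongly_measurable M (f n)"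
    and lim: "\<And>x. x \<in> space M \<Longrightarrow> (\<lambda>n. f n x) \<longlonglongrightarrow> g x"
  shows "strongly_measurable M g"
proof -
  obtain s where s: "\<And>n i. simple_function M (s n i)"
      "\<And>n x. x \<in> space M \<Longrightarrow> (\<lambda>i. s n i x) \<longlonglongrightarrow> f n x"
    using f unfolding strongly_measurable_def by metis
  define D where "D = insert 0 (\<Union>n i. s n i ` space M)"
  have "countable D"
    unfolding D_def countable_insert_eq using s(1)
    by (intro countable_UN countableI_type countable_finite) (auto simp: simple_function_def)
  then obtain d :: "nat \<Rightarrow> 'b" where d: "range d = D"
    using range_from_nat_into[of D] by (metis D_def insert_not_empty)
  have dense: "\<exists>j. norm (g x - d j) < e" if x: "x \<in> space M" and "0 < e" for x e
  proof -
    obtain n where n: "norm (f n x - g x) < e / 2"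
      using LIMSEQ_D[OF lim[OF x], of "e / 2"] \<open>0 < e\<close> by auto
    obtain i where i: "norm (s n i x - f n x) < e / 2"
      using LIMSEQ_D[OF s(2)[OF x], of "e / 2" n] \<open>0 < e\<close> by auto
    have "s n i x \<in> range d" using x by (auto simp: d D_def)
    then obtain j where "s n i x = d j" by auto
    then show ?thesis
      using norm_diff_triangle_less[OF n[unfolded norm_minus_commute[of "f n x"]]
          i[unfolded norm_minus_commute[of "s n i x"]]]
      by (auto intro!: exI[of _ j])
  qed
  have meas [measurable]: "(\<lambda>x. norm (g x - d j)) \<in> borel_measurable M" for j
  proof (rule borel_measurable_LIMSEQ_real[where u = "\<lambda>n x. norm (f n x - d j)"])
    show "(\<lambda>x. norm (f n x - d j)) \<in> borel_measurable M" for n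
      by (intro borel_measurable_norm_strongly_measurable strongly_measurable_diff f) simp
  qed (use lim in \<open>auto intro!: tendsto_intros\<close>)
  \<comment> \<open>Taking the least index resolves ties, so that \<open>idx n\<close> is a
    measurable function with values in \<open>{..n}\<close>.\<close>
  define idx where "idx n x = (LEAST i. i \<le> n \<and> (\<forall>j\<in>{..n}. norm (g x - d i) \<le> norm (g x - d j)))"
    for n x
  have idx: "idx n x \<le> n" "\<And>j. j \<le> n \<Longrightarrow> norm (g x - d (idx n x)) \<le> norm (g x - d j)" for n x
  proof -
    obtain i where "i \<in> {..n}" "\<And>j. j \<in> {..n} \<Longrightarrow> norm (g x - d i) \<le> norm (g x - d j)"
      using ex_is_arg_min_if_finite[of "{..n}" "\<lambda>j. norm (g x - d j)"]
      by (auto simp: is_arg_min_linorder)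
    then have "\<exists>i. i \<le> n \<and> (\<forall>j\<in>{..n}. norm (g x - d i) \<le> norm (g x - d j))" by auto
    from LeastI_ex[OF this] show "idx n x \<le> n"
      "\<And>j. j \<le> n \<Longrightarrow> norm (g x - d (idx n x)) \<le> norm (g x - d j)"
      unfolding idx_def by auto
  qed
  have "simple_function M (\<lambda>x. d (idx n x))" for n
  proof (rule simple_function_compose1[where g = d])
    have "idx n \<in> measurable M (count_space UNIV)" unfolding idx_def by measurable
    moreover have "finite (idx n ` space M)"
      by (rule finite_subset[of _ "{..n}"]) (auto simp: idx(1))
    ultimately show "simple_function M (idx n)"
      unfolding simple_function_def by (simp add: measurable_sets)
  qed
  moreover have "(\<lambda>n. d (idx n x)) \<longlonglongrightarrow> g x" if x: "x \<in> space M" for x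
  proof (rule LIMSEQ_I)
    fix e :: real assume "0 < e"
    then obtain j where j: "norm (g x - d j) < e" using dense[OF x] by blast
    then have "norm (d (idx n x) - g x) < e" if "j \<le> n" for n
      using idx(2)[OF that, of x] by (simp add: norm_minus_commute)
    then show "\<exists>N. \<forall>n\<ge>N. norm (d (idx n x) - g x) < e" by blast
  qed
  ultimately show ?thesis
    unfolding strongly_measurable_def by (intro exI[of _ "\<lambda>n x. d (idx n x)"]) blast
qed

lemma strongly_measurable_simple_function: "simple_function M f \<Longrightarrow> strongly_measurable M f"
  unfolding strongly_measurable_def by (intro exI[of _ "\<lambda>i. f"]) auto

lemma simple_bochner_integrable_strongly_measurable:
  "Bochner_Integration.simple_bochner_integrable M f \<Longrightarrow> strongly_measurable M f"
  by (auto elim: Bochner_Integration.simple_bochner_integrable.cases intro: strongly_measurable_simple_function)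

lemma nn_integral_norm_triangle:
  assumes "strongly_measurable M f" and "strongly_measurable M g"
  shows "(\<integral>\<^sup>+x. ennreal (norm (f x + g x)) \<partial>M)
    \<le> (\<integral>\<^sup>+x. ennreal (norm (f x)) \<partial>M) + (\<integral>\<^sup>+x. ennreal (norm (g x)) \<partial>M)"
proof -
  have [measurable]: "(\<lambda>x. norm (f x)) \<in> borel_measurable M" "(\<lambda>x. norm (g x)) \<in> borel_measurable M"
    using assms by (auto intro: borel_measurable_norm_strongly_measurable)
  have "(\<integral>\<^sup>+x. ennreal (norm (f x + g x)) \<partial>M)
      \<le> (\<integral>\<^sup>+x. ennreal (norm (f x)) + ennreal (norm (g x)) \<partial>M)"
    by (intro nn_integral_mono) (simp add: norm_triangle_ineq flip: ennreal_plus)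
  then show ?thesis by (simp add: nn_integral_add)
qed

section \<open>Additivity of the strong integral and averages of mean-zero functions\<close>

lemma has_strong_integralE:
  assumes "has_strong_integral M f a"
  obtains s where "strongly_measurable M f"
    and "\<And>i. Bochner_Integration.simple_bochner_integrable M (s i)"
    and "(\<lambda>i. \<integral>\<^sup>+x. ennreal (norm (f x - s i x)) \<partial>M) \<longlonglongrightarrow> 0"
    and "(\<lambda>i. Bochner_Integration.simple_bochner_integral M (s i)) \<longlonglongrightarrow> a"
  using assms unfolding has_strong_integral_def by (elim conjE exE) (rule that, simp_all)

lemma has_strong_integral_zero:
  "has_strong_integral M (\<lambda>x. 0 :: 'b::real_normed_vector) 0"
proof -
  let ?z = "\<lambda>x. 0 :: 'b"
  have "Bochner_Integration.simple_bochner_integrable M ?z"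
    by (auto intro!: Bochner_Integration.simple_bochner_integrable.intros)
  moreover have "Bochner_Integration.simple_bochner_integral M ?z = 0"
    by (auto simp: simple_bochner_integral_def intro!: sum.neutral)
  ultimately show ?thesis
    unfolding has_strong_integral_def by (auto intro!: exI[of _ "\<lambda>i. ?z"])
qed

lemma has_strong_integral_add:
  assumes "has_strong_integral M f a" and "has_strong_integral M g b"
  shows "has_strong_integral M (\<lambda>x. f x + g x) (a + b)"
proof -
  obtain s where f: "strongly_measurable M f"
    and s: "\<And>i. Bochner_Integration.simple_bochner_integrable M (s i)"
      "(\<lambda>i. \<integral>\<^sup>+x. ennreal (norm (f x - s i x)) \<partial>M) \<longlonglongrightarrow> 0"
      "(\<lambda>i. Bochner_Integration.simple_bochner_integral M (s i)) \<longlonglongrightarrow> a"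
    using assms(1) by (rule has_strong_integralE) blast
  obtain t where g: "strongly_measurable M g"
    and t: "\<And>i. Bochner_Integration.simple_bochner_integrable M (t i)"
      "(\<lambda>i. \<integral>\<^sup>+x. ennreal (norm (g x - t i x)) \<partial>M) \<longlonglongrightarrow> 0"
      "(\<lambda>i. Bochner_Integration.simple_bochner_integral M (t i)) \<longlonglongrightarrow> b"
    using assms(2) by (rule has_strong_integralE) blast
  let ?u = "\<lambda>i x. s i x + t i x"
  have u: "Bochner_Integration.simple_bochner_integrable M (?u i)" for i
    using s(1) t(1) by (intro simple_bochner_integrable_compose2[where p = "(+)"]) auto
  have "(\<lambda>i. \<integral>\<^sup>+x. ennreal (norm (f x + g x - ?u i x)) \<partial>M) \<longlonglongrightarrow> 0"
  proof (rule tendsto_sandwich[OF _ _ tendsto_const])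
    show "\<forall>\<^sub>F i in sequentially. (\<integral>\<^sup>+x. ennreal (norm (f x + g x - ?u i x)) \<partial>M)
        \<le> (\<integral>\<^sup>+x. ennreal (norm (f x - s i x)) \<partial>M) + (\<integral>\<^sup>+x. ennreal (norm (g x - t i x)) \<partial>M)"
    proof (intro always_eventually allI)
      fix i
      have "strongly_measurable M (\<lambda>x. f x - s i x)" "strongly_measurable M (\<lambda>x. g x - t i x)"
        using f g s(1) t(1)
        by (auto intro: strongly_measurable_diff simple_bochner_integrable_strongly_measurable)
      from nn_integral_norm_triangle[OF this, unfolded add_diff_add[symmetric]]
      show "(\<integral>\<^sup>+x. ennreal (norm (f x + g x - ?u i x)) \<partial>M)
        \<le> (\<integral>\<^sup>+x. ennreal (norm (f x - s i x)) \<partial>M) + (\<integral>\<^sup>+x. ennreal (norm (g x - t i x)) \<partial>M)" .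
    qed
    show "(\<lambda>i. (\<integral>\<^sup>+x. ennreal (norm (f x - s i x)) \<partial>M) + (\<integral>\<^sup>+x. ennreal (norm (g x - t i x)) \<partial>M))
        \<longlonglongrightarrow> 0"
      using tendsto_add[OF s(2) t(2)] by simp
  qed simp
  moreover have "(\<lambda>i. Bochner_Integration.simple_bochner_integral M (?u i)) \<longlonglongrightarrow> a + b"
    using tendsto_add[OF s(3) t(3)] s(1) t(1) by (simp add: simple_bochner_integral_add)
  ultimately show ?thesis
    unfolding has_strong_integral_def
    by (intro conjI strongly_measurable_add[OF f g] exI[of _ ?u] allI u)
qed

lemma has_strong_integral_sum_zero:
  assumes "\<And>i. i \<in> I \<Longrightarrow> has_strong_integral M (f i) 0"
  shows "has_strong_integral M (\<lambda>x. \<Sum>i\<in>I. f i x) 0"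
  using assms
proof (induction I rule: infinite_finite_induct)
  case (insert i I)
  then have "has_strong_integral M (\<lambda>x. f i x + (\<Sum>j\<in>I. f j x)) (0 + 0)"
    by (intro has_strong_integral_add) auto
  then show ?case using insert by simp
qed (simp_all add: has_strong_integral_zero)

lemma simple_bochner_integral_indicator:
  assumes A: "A \<in> sets M" "emeasure M A < \<infinity>"
  shows "Bochner_Integration.simple_bochner_integrable M (\<lambda>x. indicator A x *\<^sub>R v)"
    and "Bochner_Integration.simple_bochner_integral M (\<lambda>x. indicator A x *\<^sub>R v) = measure M A *\<^sub>R v"
proof -
  have ind: "Bochner_Integration.simple_bochner_integrable M (indicator A :: _ \<Rightarrow> real)"
  proof
    show "simple_function M (indicator A :: _ \<Rightarrow> real)" using A(1) by (rule simple_function_indicator)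
    have "{y \<in> space M. indicator A y \<noteq> (0::real)} = A"
      using sets.sets_into_space[OF A(1)] by (auto simp: indicator_def)
    then show "emeasure M {y \<in> space M. indicator A y \<noteq> (0::real)} \<noteq> \<infinity>" using A(2) by simp
  qed
  then show "Bochner_Integration.simple_bochner_integrable M (\<lambda>x. indicator A x *\<^sub>R v)"
    using simple_bochner_integrable_compose2[where p = "\<lambda>r s. r *\<^sub>R v", OF _ ind ind] by simp
  interpret linear "\<lambda>r::real. r *\<^sub>R v" by (rule linear_scale_left)
  have "ennreal (Bochner_Integration.simple_bochner_integral M (indicator A)) = emeasure M A"
    using simple_bochner_integral_eq_nn_integral[OF ind] A(1) by (simp add: ennreal_indicator)
  then have "Bochner_Integration.simple_bochner_integral M (indicator A) = measure M A"
    by (metis Sigma_Algebra.measure_def enn2real_ennreal indicator_pos_le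
        simple_bochner_integral_nonneg)
  then show "Bochner_Integration.simple_bochner_integral M (\<lambda>x. indicator A x *\<^sub>R v) = measure M A *\<^sub>R v"
    using simple_bochner_integral_linear[OF linear_axioms ind] by simp
qed

text \<open>The integrand on the right has integral \<open>measure M A *\<^sub>R v\<close>, because
  \<open>f\<close> contributes nothing, and the norm of an integral is at most the integral of the
  norm. This is carried out for simple approximants of \<open>f\<close> and passed to the
  limit.\<close>

lemma norm_emeasure_le_nn_integral_mean_zero:
  assumes f: "has_strong_integral M f 0" and A: "A \<in> sets M" "emeasure M A < \<infinity>"
  shows "ennreal (norm v) * emeasure M A \<le> (\<integral>\<^sup>+x. ennreal (norm (indicator A x *\<^sub>R v + f x)) \<partial>M)"
proof -
  obtain s where fm: "strongly_measurable M f"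
    and s: "\<And>i. Bochner_Integration.simple_bochner_integrable M (s i)"
      "(\<lambda>i. \<integral>\<^sup>+x. ennreal (norm (f x - s i x)) \<partial>M) \<longlonglongrightarrow> 0"
      "(\<lambda>i. Bochner_Integration.simple_bochner_integral M (s i)) \<longlonglongrightarrow> 0"
    using f by (rule has_strong_integralE) blast
  let ?v = "\<lambda>x. indicator A x *\<^sub>R v"
  let ?I = "\<integral>\<^sup>+x. ennreal (norm (?v x + f x)) \<partial>M"
  note v = simple_bochner_integral_indicator[OF A, of v]
  have le: "ennreal (norm (measure M A *\<^sub>R v + Bochner_Integration.simple_bochner_integral M (s i)))
      \<le> ?I + (\<integral>\<^sup>+x. ennreal (norm (f x - s i x)) \<partial>M)" for i
  proof -
    have vs: "Bochner_Integration.simple_bochner_integrable M (\<lambda>x. ?v x + s i x)"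
      using v(1) s(1) by (intro simple_bochner_integrable_compose2[where p = "(+)"]) auto
    have "Bochner_Integration.simple_bochner_integrable M (\<lambda>x. norm (?v x + s i x))"
      using simple_bochner_integrable_compose2[where p = "\<lambda>x y. norm x", OF _ vs vs] by simp
    then have "ennreal (Bochner_Integration.simple_bochner_integral M (\<lambda>x. norm (?v x + s i x)))
        = (\<integral>\<^sup>+x. ennreal (norm (?v x + s i x)) \<partial>M)"
      by (rule simple_bochner_integral_eq_nn_integral) simp
    moreover have "ennreal (norm (Bochner_Integration.simple_bochner_integral M (\<lambda>x. ?v x + s i x)))
        \<le> ennreal (Bochner_Integration.simple_bochner_integral M (\<lambda>x. norm (?v x + s i x)))"
      using simple_bochner_integral_norm_bound[OF vs] by (rule ennreal_leI)
    ultimately have "ennreal (norm (measure M A *\<^sub>R v + Bochner_Integration.simple_bochner_integral M (s i)))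
        \<le> (\<integral>\<^sup>+x. ennreal (norm (?v x + s i x)) \<partial>M)"
      using v s(1) by (simp add: simple_bochner_integral_add)
    also have "\<dots> = (\<integral>\<^sup>+x. ennreal (norm ((?v x + f x) + (s i x - f x))) \<partial>M)"
      by simp
    also have "\<dots> \<le> ?I + (\<integral>\<^sup>+x. ennreal (norm (s i x - f x)) \<partial>M)"
      using fm v(1) s(1)
      by (intro nn_integral_norm_triangle strongly_measurable_add strongly_measurable_diff
          simple_bochner_integrable_strongly_measurable[OF v(1)]
          simple_bochner_integrable_strongly_measurable[OF s(1)])
    finally show ?thesis by (simp add: norm_minus_commute)
  qed
  have lim1: "(\<lambda>i. ennreal (norm (measure M A *\<^sub>R v + Bochner_Integration.simple_bochner_integral M (s i))))
      \<longlonglongrightarrow> ennreal (norm (measure M A *\<^sub>R v + 0))"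
    by (intro tendsto_ennrealI tendsto_norm tendsto_add tendsto_const s(3))
  have lim2: "(\<lambda>i. ?I + (\<integral>\<^sup>+x. ennreal (norm (f x - s i x)) \<partial>M)) \<longlonglongrightarrow> ?I + 0"
    by (intro tendsto_add tendsto_const s(2))
  have "ennreal (norm (measure M A *\<^sub>R v + 0)) \<le> ?I + 0"
    using LIMSEQ_le[OF lim1 lim2] le by blast
  moreover have "emeasure M A = ennreal (measure M A)"
    using A(2) by (intro emeasure_eq_ennreal_measure) auto
  ultimately show ?thesis by (simp add: ennreal_mult mult.commute)
qed

text \<open>A single simple approximant at \<open>L1\<close> distance below 1 suffices, since simple
  integrable functions have finite norm integral. This later excludes nonzero constant values on
  cubes of infinite measure.\<close>

lemma has_strong_integral_norm_finite:
  assumes "has_strong_integral M f a"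
  shows "(\<integral>\<^sup>+x. ennreal (norm (f x)) \<partial>M) < \<infinity>"
proof -
  obtain s where fm: "strongly_measurable M f"
    and s: "\<And>i. Bochner_Integration.simple_bochner_integrable M (s i)"
      "(\<lambda>i. \<integral>\<^sup>+x. ennreal (norm (f x - s i x)) \<partial>M) \<longlonglongrightarrow> 0"
    using assms by (rule has_strong_integralE) blast
  have "\<forall>\<^sub>F i in sequentially. (\<integral>\<^sup>+x. ennreal (norm (f x - s i x)) \<partial>M) < 1"
    using order_tendstoD(2)[OF s(2), of 1] by simp
  then obtain i where i: "(\<integral>\<^sup>+x. ennreal (norm (f x - s i x)) \<partial>M) < 1"
    by (auto dest: eventually_happens)
  have sm: "strongly_measurable M (s i)"
    using s(1) by (rule simple_bochner_integrable_strongly_measurable)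
  have "Bochner_Integration.simple_bochner_integrable M (\<lambda>x. norm (s i x))"
    using simple_bochner_integrable_compose2[where p = "\<lambda>x y. norm x", OF _ s(1) s(1)] by simp
  then have "(\<integral>\<^sup>+x. ennreal (norm (s i x)) \<partial>M) < \<infinity>"
    by (subst simple_bochner_integral_eq_nn_integral[symmetric]) auto
  moreover have "(\<integral>\<^sup>+x. ennreal (norm ((f x - s i x) + s i x)) \<partial>M)
      \<le> (\<integral>\<^sup>+x. ennreal (norm (f x - s i x)) \<partial>M) + (\<integral>\<^sup>+x. ennreal (norm (s i x)) \<partial>M)"
    by (intro nn_integral_norm_triangle strongly_measurable_diff fm sm)
  ultimately show ?thesis
    using i by (auto simp: less_top[symmetric] top_unique)
qed

section \<open>\<open>L\<^sup>p\<close> norms\<close>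

lemma epowr_top [simp]: "epowr top a = top"
  by (simp add: epowr_def)

lemma epowr_ennreal: "0 \<le> r \<Longrightarrow> epowr (ennreal r) a = ennreal (r powr a)"
  by (simp add: epowr_def)

lemma epowr_zero [simp]: "epowr 0 a = 0"
  by (simp add: epowr_def)

lemma epowr_one [simp]: "epowr x 1 = x"
  by (cases x) (simp_all add: epowr_ennreal)

lemma epowr_mono: "0 \<le> a \<Longrightarrow> x \<le> y \<Longrightarrow> epowr x a \<le> epowr y a"
  by (cases x; cases y) (auto simp: epowr_ennreal top_unique intro!: ennreal_leI powr_mono2)

lemma epowr_epowr: "epowr (epowr x a) b = epowr x (a * b)"
  by (cases x) (simp_all add: epowr_ennreal powr_powr)

lemma epowr_mult:
  assumes "0 < a"
  shows "epowr (x * y) a = epowr x a * epowr y a"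
proof (cases "x = top \<or> y = top")
  case False
  then obtain r s where "x = ennreal r" "0 \<le> r" "y = ennreal s" "0 \<le> s"
    by (cases x; cases y) auto
  then show ?thesis
    by (simp add: epowr_ennreal powr_mult ennreal_mult[symmetric])
next
  case True
  have top: "epowr (z * top) a = epowr z a * top" for z
  proof (cases "z = 0")
    case False
    then have "epowr z a \<noteq> 0" by (cases z) (auto simp: epowr_ennreal)
    then show ?thesis using False by (simp add: ennreal_mult_top)
  qed simp
  from True show ?thesis
  proof
    assume "x = top"
    then show ?thesis using top[of y] by (simp add: mult.commute)
  qed (simp add: top)
qed

lemma epowr_le_iff:
  assumes "0 < a"
  shows "epowr x (1 / a) \<le> y \<longleftrightarrow> x \<le> epowr y a"
  using epowr_mono[of a "epowr x (1 / a)" y] epowr_mono[of "1 / a" x "epowr y a"] assms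
  by (auto simp: epowr_epowr)

lemma epowr_Lp_norm:
  "0 < p \<Longrightarrow> epowr (Lp_norm M p f) p = (\<integral>\<^sup>+x. ennreal (norm (f x) powr p) \<partial>M)"
  by (simp add: Lp_norm_def epowr_epowr)

lemma Lp_norm_le_iff:
  "0 < p \<Longrightarrow> Lp_norm M p f \<le> C \<longleftrightarrow> (\<integral>\<^sup>+x. ennreal (norm (f x) powr p) \<partial>M) \<le> epowr C p"
  by (simp add: Lp_norm_def epowr_le_iff)

lemma infsum_ennreal_le_iff:
  fixes b :: "'i \<Rightarrow> ennreal"
  shows "(\<Sum>\<^sub>\<infinity>i\<in>I. b i) \<le> C \<longleftrightarrow> (\<forall>F. finite F \<and> F \<subseteq> I \<longrightarrow> (\<Sum>i\<in>F. b i) \<le> C)"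
  by (subst nonneg_infsum_complete) (auto simp: SUP_le_iff)

text \<open>A sum in \<open>[0,\<infinity>]\<close> is the supremum of its finite partial sums, so
  bounds on the mixed norm can be tested on finite subfamilies.\<close>

lemma lp_Lp_norm_le_iff:
  assumes "0 < p"
  shows "lp_Lp_norm M p I f \<le> C \<longleftrightarrow> (\<forall>F. finite F \<and> F \<subseteq> I \<longrightarrow>
    (\<Sum>i\<in>F. \<integral>\<^sup>+x. ennreal (norm (f i x) powr p) \<partial>M) \<le> epowr C p)"
  using assms by (simp add: lp_Lp_norm_def epowr_le_iff infsum_ennreal_le_iff epowr_Lp_norm)

lemma measurable_norm_powr:
  assumes "strongly_measurable M f"
  shows "(\<lambda>x. norm (f x) powr p) \<in> borel_measurable M"
proof -
  note [measurable] = borel_measurable_norm_strongly_measurable[OF assms]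
  show ?thesis by measurable
qed

lemma Lp_norm_minus_commute:
  "Lp_norm M p (\<lambda>x. f x - g x) = Lp_norm M p (\<lambda>x. g x - f x)"
  by (simp add: Lp_norm_def norm_minus_commute)

text \<open>Minkowski's inequality from convexity: with the weight \<open>b / (a + b)\<close> the
  two weighted terms add up to exactly \<open>(a + b) powr p\<close>. Strict positivity of the
  bounds keeps the weight inside the open unit interval.\<close>

lemma Lp_norm_triangle_le:
  assumes p: "1 \<le> p" and f: "strongly_measurable M f" and g: "strongly_measurable M g"
    and a: "0 < a" "Lp_norm M p f \<le> ennreal a" and b: "0 < b" "Lp_norm M p g \<le> ennreal b"
  shows "Lp_norm M p (\<lambda>x. f x + g x) \<le> ennreal (a + b)"
proof -
  define \<theta> where "\<theta> = b / (a + b)"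
  have \<theta>: "0 < \<theta>" "\<theta> < 1" and \<theta>': "1 - \<theta> = a / (a + b)"
    using a b by (auto simp: \<theta>_def field_simps)
  note [measurable] = measurable_norm_powr[OF f] measurable_norm_powr[OF g]
  have "(\<integral>\<^sup>+x. ennreal (norm (f x + g x) powr p) \<partial>M)
      \<le> (\<integral>\<^sup>+x. ennreal ((1 - \<theta>) powr (1 - p)) * ennreal (norm (f x) powr p)
            + ennreal (\<theta> powr (1 - p)) * ennreal (norm (g x) powr p) \<partial>M)"
  proof (intro nn_integral_mono)
    fix x
    have "norm (f x + g x) powr p \<le> (norm (f x) + norm (g x)) powr p"
      using p by (intro powr_mono2 norm_triangle_ineq) auto
    also have "\<dots> \<le> (1 - \<theta>) powr (1 - p) * norm (f x) powr p + \<theta> powr (1 - p) * norm (g x) powr p"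
      by (rule powr_add_weighted_le) (use p \<theta> in auto)
    finally show "ennreal (norm (f x + g x) powr p) \<le> ennreal ((1 - \<theta>) powr (1 - p)) * ennreal (norm (f x) powr p)
            + ennreal (\<theta> powr (1 - p)) * ennreal (norm (g x) powr p)"
      by (simp add: ennreal_leI flip: ennreal_mult ennreal_plus)
  qed
  also have "\<dots> = ennreal ((1 - \<theta>) powr (1 - p)) * epowr (Lp_norm M p f) p
      + ennreal (\<theta> powr (1 - p)) * epowr (Lp_norm M p g) p"
    using p by (simp add: nn_integral_add nn_integral_cmult epowr_Lp_norm)
  also have "\<dots> \<le> ennreal ((1 - \<theta>) powr (1 - p)) * epowr (ennreal a) p
      + ennreal (\<theta> powr (1 - p)) * epowr (ennreal b) p"
    using p a b by (intro add_mono mult_left_mono epowr_mono) auto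
  also have "\<dots> = ennreal ((1 - \<theta>) powr (1 - p) * a powr p + \<theta> powr (1 - p) * b powr p)"
    using a b by (simp add: epowr_ennreal flip: ennreal_mult)
  also have "(1 - \<theta>) powr (1 - p) * a powr p + \<theta> powr (1 - p) * b powr p = (a + b) powr p"
  proof -
    have *: "(c / (a + b)) powr (1 - p) * c powr p = c * (a + b) powr (p - 1)" if "0 < c" for c
      using that a b by (simp add: powr_divide powr_diff)
    have "(a + b) * (a + b) powr (p - 1) = (a + b) powr p"
      using a b by (simp add: powr_diff)
    then show ?thesis using *[OF a(1)] *[OF b(1)]
      unfolding \<theta>' by (simp add: \<theta>_def distrib_right)
  qed
  finally show ?thesis
    using p a b by (subst Lp_norm_le_iff) (simp_all add: epowr_ennreal del: ennreal_plus)
qed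

lemma Lp_norm_triangle:
  assumes p: "1 \<le> p" and f: "strongly_measurable M f" and g: "strongly_measurable M g"
  shows "Lp_norm M p (\<lambda>x. f x + g x) \<le> Lp_norm M p f + Lp_norm M p g"
proof (cases "Lp_norm M p f = top \<or> Lp_norm M p g = top")
  case False
  then obtain a b where a: "0 \<le> a" "Lp_norm M p f = ennreal a"
    and b: "0 \<le> b" "Lp_norm M p g = ennreal b"
    by (cases "Lp_norm M p f"; cases "Lp_norm M p g") auto
  \<comment> \<open>Enlarging both norms by \<open>e / 2\<close> makes the bounds positive, also
    when a norm vanishes.\<close>
  have "Lp_norm M p (\<lambda>x. f x + g x) \<le> ennreal (a + b) + ennreal e" if "0 < e" for e
  proof -
    have "Lp_norm M p (\<lambda>x. f x + g x) \<le> ennreal ((a + e / 2) + (b + e / 2))"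
      using that a b by (intro Lp_norm_triangle_le p f g) (auto intro!: ennreal_leI)
    then show ?thesis using that a b by (simp add: ac_simps flip: ennreal_plus)
  qed
  then have "Lp_norm M p (\<lambda>x. f x + g x) \<le> ennreal (a + b)"
    by (rule ennreal_le_epsilon)
  then show ?thesis using a b by simp
next
  case True
  then show ?thesis by (elim disjE) simp_all
qed

section \<open>Sparse collections of dyadic cubes\<close>

text \<open>Scaling by \<open>2 powi k\<close> turns the half-open sides into unit intervals with
  integer endpoints, so that nesting of cubes becomes arithmetic of floors.\<close>

lemma mem_dyadic_cube_iff: "x \<in> dyadic_cube k m \<longleftrightarrow> (\<forall>i. \<lfloor>2 powi k * x $ i\<rfloor> = m i)"
proof -
  have "0 < (2::real) powi k" by simp
  then have "2 powi (- k) * of_int (m i) \<le> x $ i \<and> x $ i < 2 powi (- k) * of_int (m i + 1)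
      \<longleftrightarrow> of_int (m i) \<le> 2 powi k * x $ i \<and> 2 powi k * x $ i < of_int (m i) + 1" for i
    by (simp add: power_int_minus field_simps)
  then show ?thesis by (simp add: dyadic_cube_def floor_eq_iff)
qed

lemma dyadic_cube_nonempty: "dyadic_cube k m \<noteq> {}"
proof -
  have "(\<chi> i. 2 powi (- k) * of_int (m i)) \<in> dyadic_cube k m"
    by (simp add: dyadic_cube_def)
  then show ?thesis by blast
qed

lemma dyadic_cubes_nonempty: "A \<in> dyadic_cubes \<Longrightarrow> A \<noteq> {}"
  by (auto simp: dyadic_cubes_def dyadic_cube_nonempty)

text \<open>The floor at the coarser level is the integer quotient of the floor at the finer level
  by \<open>2 ^ nat (k' - k)\<close>. Points with the same fine index therefore share the coarse
  index.\<close>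

lemma dyadic_cube_subset:
  assumes k: "k \<le> k'" and x: "x \<in> dyadic_cube k m" "x \<in> dyadic_cube k' m'"
  shows "dyadic_cube k' m' \<subseteq> dyadic_cube k m"
proof
  fix y assume y: "y \<in> dyadic_cube k' m'"
  define N :: int where "N = 2 ^ nat (k' - k)"
  have "\<lfloor>2 powi k * z\<rfloor> = \<lfloor>2 powi k' * z\<rfloor> div N" for z :: real
  proof -
    have "(2::real) powi k' = 2 powi k * of_int N"
      using k power_int_add[of "2::real" k "k' - k"] by (simp add: N_def power_int_def)
    then have "2 powi k * z = 2 powi k' * z / of_int N" by (simp add: N_def)
    then show ?thesis using floor_divide_real_eq_div[of N "2 powi k' * z"] by (simp add: N_def)
  qed
  then show "y \<in> dyadic_cube k m"
    using x y by (simp add: mem_dyadic_cube_iff)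
qed

lemma dyadic_cubes_nested:
  assumes "A \<in> dyadic_cubes" and "B \<in> dyadic_cubes" and "A \<inter> B \<noteq> {}"
  shows "A \<subseteq> B \<or> B \<subseteq> A"
proof -
  obtain k m k' m' where AB: "A = dyadic_cube k m" "B = dyadic_cube k' m'"
    using assms(1,2) by (auto simp: dyadic_cubes_def)
  obtain x where "x \<in> A" "x \<in> B" using assms(3) by auto
  then show ?thesis
    using dyadic_cube_subset[of k k' x m m'] dyadic_cube_subset[of k' k x m' m]
    unfolding AB by linarith
qed

lemma dyadic_cube_level_less:
  assumes "dyadic_cube k' m' \<subset> dyadic_cube k m"
  shows "k < k'"
proof (rule ccontr)
  assume "\<not> k < k'"
  moreover obtain x where "x \<in> dyadic_cube k' m'" using dyadic_cube_nonempty by blast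
  ultimately have "dyadic_cube k m \<subseteq> dyadic_cube k' m'"
    using assms by (intro dyadic_cube_subset) auto
  then show False using assms by blast
qed

lemma countable_dyadic_cubes: "countable (dyadic_cubes :: (real^'n::finite) set set)"
proof -
  have "(dyadic_cubes :: (real^'n) set set) \<subseteq> range (\<lambda>(k, m). dyadic_cube k m)"
    by (auto simp: dyadic_cubes_def)
  then show ?thesis
    by (rule countable_subset) (intro countable_image countableI_type)
qed

lemma borel_dyadic_cubes: "A \<in> dyadic_cubes \<Longrightarrow> A \<in> sets borel"
proof -
  assume "A \<in> dyadic_cubes"
  then obtain k m where "A = dyadic_cube k m" by (auto simp: dyadic_cubes_def)
  then have "A = {x \<in> space borel. \<forall>i. \<lfloor>2 powi k * x $ i\<rfloor> = m i}"
    by (auto simp: mem_dyadic_cube_iff)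
  then show ?thesis by simp
qed

text \<open>The hypotheses form a locale so that the estimates for finite collections can be
  interpreted for finite subcollections of an infinite one.\<close>

locale sparse_dyadic =
  fixes \<mu> :: "(real^'n::finite) measure" and \<S> :: "(real^'n) set set"
  assumes borel: "sets \<mu> = sets borel"
    and dyadic: "\<S> \<subseteq> dyadic_cubes"
    and sparse: "sparse_collection \<mu> \<S>"
begin

lemma sets_cube [measurable]: "S \<in> \<S> \<Longrightarrow> S \<in> sets \<mu>"
  using borel dyadic borel_dyadic_cubes by auto

lemma countable_cubes: "countable \<S>"
  using countable_subset[OF dyadic countable_dyadic_cubes] .

lemma space_eq [simp]: "space \<mu> = UNIV"
  using sets_eq_imp_space_eq[OF borel] by simp

lemma cube_nonempty: "S \<in> \<S> \<Longrightarrow> S \<noteq> {}"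
  using dyadic dyadic_cubes_nonempty by auto

lemma nested: "S \<in> \<S> \<Longrightarrow> T \<in> \<S> \<Longrightarrow> x \<in> S \<Longrightarrow> x \<in> T \<Longrightarrow> S \<subseteq> T \<or> T \<subseteq> S"
  using dyadic dyadic_cubes_nested[of S T] by auto

lemma nested_superset:
  "S \<in> \<S> \<Longrightarrow> T \<in> \<S> \<Longrightarrow> R \<in> \<S> \<Longrightarrow> R \<subseteq> S \<Longrightarrow> R \<subseteq> T \<Longrightarrow> S \<subseteq> T \<or> T \<subseteq> S"
  using cube_nonempty[of R] nested[of S T] by blast

lemma chD: "T \<in> ch \<S> S \<Longrightarrow> T \<in> \<S> \<and> T \<subset> S"
  by (simp add: ch_def)

lemma ch_maximal: "T \<in> ch \<S> S \<Longrightarrow> R \<in> \<S> \<Longrightarrow> R \<subset> S \<Longrightarrow> T \<subseteq> R \<Longrightarrow> R = T"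
  by (simp add: ch_def)

text \<open>The cubes of the collection between \<open>R\<close> and \<open>S\<close> have integer
  levels above that of \<open>S\<close>, so one of least level exists; it is a maximal one. No
  finiteness of the collection enters.\<close>

lemma ex_ch_superset:
  assumes S: "S \<in> \<S>" and R: "R \<in> \<S>" and sub: "R \<subset> S"
  obtains T where "T \<in> ch \<S> S" and "R \<subseteq> T"
proof -
  obtain kS mS where kS: "S = dyadic_cube kS mS" using S dyadic by (auto simp: dyadic_cubes_def)
  obtain kR mR where kR: "R = dyadic_cube kR mR" using R dyadic by (auto simp: dyadic_cubes_def)
  let ?P = "\<lambda>(k, m). dyadic_cube k m \<in> \<S> \<and> R \<subseteq> dyadic_cube k m \<and> dyadic_cube k m \<subset> S"
  have "?P (kR, mR)" using R sub by (simp add: kR)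
  then obtain q where q: "?P q" "\<And>r. ?P r \<Longrightarrow>
      (case q of (k, m) \<Rightarrow> nat (k - kS)) \<le> (case r of (k, m) \<Rightarrow> nat (k - kS))"
    using ex_has_least_nat[of ?P "(kR, mR)" "\<lambda>(k, m). nat (k - kS)"] by blast
  obtain k m where km: "q = (k, m)" by (cases q)
  have P: "?P (k, m)" using q(1) unfolding km .
  have min: "nat (k - kS) \<le> nat (k' - kS)" if "?P (k', m')" for k' m'
    using q(2)[OF that] by (simp add: km)
  have level: "kS < k'" if "?P (k', m')" for k' m'
    using that unfolding kS by (auto intro: dyadic_cube_level_less)
  \<comment> \<open>A strictly larger candidate would have a strictly smaller level, against
    minimality. Applying \<open>nat\<close> in the minimisation loses nothing, as all levels
    concerned exceed \<open>kS\<close>.\<close>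
  have "T = dyadic_cube k m" if T: "T \<in> \<S>" "T \<subset> S" "dyadic_cube k m \<subseteq> T" for T
  proof (rule ccontr)
    assume "T \<noteq> dyadic_cube k m"
    obtain k' m' where k': "T = dyadic_cube k' m'" using T(1) dyadic by (auto simp: dyadic_cubes_def)
    have "?P (k', m')" using T P by (auto simp flip: k')
    with min level have "k \<le> k'" by fastforce
    moreover have "k' < k"
      using T(3) \<open>T \<noteq> dyadic_cube k m\<close> unfolding k' by (intro dyadic_cube_level_less) auto
    ultimately show False by simp
  qed
  with P have "dyadic_cube k m \<in> ch \<S> S" by (auto simp: ch_def)
  with P show ?thesis using that by auto
qed

lemma ch_disjoint:
  assumes "T \<in> ch \<S> S" and "T' \<in> ch \<S> S" and "x \<in> T" and "x \<in> T'"
  shows "T = T'"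
  using nested[of T T' x] ch_maximal[OF assms(1), of T'] ch_maximal[OF assms(2), of T]
    chD[OF assms(1)] chD[OF assms(2)] assms(3,4)
  by metis

text \<open>Two parents of \<open>T\<close> are comparable, as both contain \<open>T\<close>; a
  strict inclusion between them would put the smaller one between \<open>T\<close> and the larger
  one, against maximality of \<open>T\<close>.\<close>

lemma parent_unique:
  assumes "S \<in> \<S>" and "S' \<in> \<S>" and T: "T \<in> ch \<S> S" "T \<in> ch \<S> S'"
  shows "S = S'"
proof -
  have "S \<subseteq> S' \<or> S' \<subseteq> S"
    using nested_superset[OF assms(1,2), of T] chD[OF T(1)] chD[OF T(2)]
    by (simp add: psubset_eq)
  then show ?thesis
    using ch_maximal[OF T(1) assms(2)] ch_maximal[OF T(2) assms(1)] chD[OF T(1)] chD[OF T(2)]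
    by (metis psubset_eq)
qed

lemma E_part_subset: "E_part \<S> S \<subseteq> S"
  by (auto simp: E_part_def)

text \<open>Only the children are removed from \<open>S\<close>, but every strictly smaller cube of
  the collection lies in a child.\<close>

lemma E_part_not_in_smaller:
  assumes "S \<in> \<S>" and "R \<in> \<S>" and "R \<subset> S" and "x \<in> E_part \<S> S"
  shows "x \<notin> R"
proof -
  obtain T where "T \<in> ch \<S> S" "R \<subseteq> T" using ex_ch_superset[OF assms(1-3)] .
  then show ?thesis using assms(4) by (auto simp: E_part_def)
qed

lemma E_part_disjoint:
  assumes "S \<in> \<S>" and "T \<in> \<S>" and x: "x \<in> E_part \<S> S" "x \<in> E_part \<S> T"
  shows "S = T"
  using nested[of S T x] E_part_not_in_smaller[of S T x] E_part_not_in_smaller[of T S x]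
    E_part_subset assms by blast

lemma sets_E_part [measurable]: "S \<in> \<S> \<Longrightarrow> E_part \<S> S \<in> sets \<mu>"
proof -
  assume S: "S \<in> \<S>"
  have sub: "ch \<S> S \<subseteq> \<S>" by (auto simp: ch_def)
  have "\<Union>(ch \<S> S) \<in> sets \<mu>"
    using countable_subset[OF sub countable_cubes] sub sets_cube
    by (intro sets.countable_Union) auto
  then show ?thesis using S unfolding E_part_def by auto
qed

lemma emeasure_cube_le: "S \<in> \<S> \<Longrightarrow> emeasure \<mu> S \<le> 2 * emeasure \<mu> (E_part \<S> S)"
proof -
  assume "S \<in> \<S>"
  then have "2 * (emeasure \<mu> S / 2) \<le> 2 * emeasure \<mu> (E_part \<S> S)"
    using sparse by (intro mult_left_mono) (auto simp: sparse_collection_def)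
  also have "2 * (emeasure \<mu> S / 2) = emeasure \<mu> S"
    by (simp add: ennreal_times_divide mult.commute[of 2] mult_divide_eq_ennreal)
  finally show ?thesis .
qed

text \<open>Each child within the smaller collection lies in a child within the larger one, so the
  sets \<open>E_part\<close> can only grow.\<close>

lemma subcollection:
  assumes sub: "\<T> \<subseteq> \<S>"
  shows "sparse_dyadic \<mu> \<T>"
proof
  show "sets \<mu> = sets borel" by (rule borel)
  show "\<T> \<subseteq> dyadic_cubes" using sub dyadic by simp
  show "sparse_collection \<mu> \<T>"
    unfolding sparse_collection_def
  proof
    fix S assume S: "S \<in> \<T>"
    have "\<Union>(ch \<T> S) \<subseteq> \<Union>(ch \<S> S)"
    proof (intro Union_least)
      fix T assume "T \<in> ch \<T> S"
      then have "S \<in> \<S>" "T \<in> \<S>" "T \<subset> S" using S sub by (auto simp: ch_def)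
      then obtain T' where "T' \<in> ch \<S> S" "T \<subseteq> T'" by (rule ex_ch_superset)
      then show "T \<subseteq> \<Union>(ch \<S> S)" by blast
    qed
    then have "E_part \<S> S \<subseteq> E_part \<T> S" unfolding E_part_def by blast
    moreover have "E_part \<T> S \<in> sets \<mu>"
    proof -
      have "ch \<T> S \<subseteq> \<S>" using sub by (auto simp: ch_def)
      then have "\<Union>(ch \<T> S) \<in> sets \<mu>"
        using countable_subset[OF _ countable_cubes] sets_cube
        by (intro sets.countable_Union) auto
      then show ?thesis using S sub unfolding E_part_def by auto
    qed
    ultimately have "emeasure \<mu> (E_part \<S> S) \<le> emeasure \<mu> (E_part \<T> S)"
      by (rule emeasure_mono)
    then show "emeasure \<mu> S / 2 \<le> emeasure \<mu> (E_part \<T> S)"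
      using S sub sparse unfolding sparse_collection_def by (meson order_trans subsetD)
  qed
qed

lemma adapted_subcollection:
  assumes sub: "\<T> \<subseteq> \<S>" and f: "adapted \<mu> \<S> f"
  shows "adapted \<mu> \<T> f"
  unfolding adapted_def
proof (intro ballI conjI)
  fix S T assume S: "S \<in> \<T>" and T: "T \<in> ch \<T> S"
  then have "S \<in> \<S>" "T \<in> \<S>" "T \<subset> S" using sub by (auto simp: ch_def)
  then obtain T' where "T' \<in> ch \<S> S" "T \<subseteq> T'" by (rule ex_ch_superset)
  then show "f S constant_on T"
    using f \<open>S \<in> \<S>\<close> constant_on_subset unfolding adapted_def by blast
qed (use f sub in \<open>auto simp: adapted_def\<close>)

text \<open>Constancy on the children extends to every strictly smaller cube, which lies in one of
  them.\<close>

lemma adapted_eq: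
  assumes f: "adapted \<mu> \<S> f" and "S \<in> \<S>" and "R \<in> \<S>" and "R \<subset> S" and "x \<in> R" and "y \<in> R"
  shows "f S x = f S y"
proof -
  obtain T where "T \<in> ch \<S> S" "R \<subseteq> T" using ex_ch_superset[OF assms(2-4)] .
  then show ?thesis using f assms unfolding adapted_def constant_on_def by (metis subsetD)
qed

end

section \<open>The Carleson embedding and its dual\<close>

lemma sum_ennreal_indicator:
  assumes "\<And>i. i \<in> I \<Longrightarrow> 0 \<le> c i"
  shows "(\<Sum>i\<in>I. ennreal (c i) * indicator (A i) x) = ennreal (\<Sum>i\<in>I. c i * indicator (A i) x)"
proof -
  have "ennreal (c i) * indicator (A i) x = ennreal (c i * indicator (A i) x)" for i
    by (cases "x \<in> A i") auto
  then show ?thesis using assms by (simp add: sum_ennreal)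
qed

context sparse_dyadic
begin

text \<open>The cubes containing \<open>x\<close> form a chain, to which
  \<open>powr_chain_sum_le\<close> applies; Young's inequality is then used in every term.\<close>

lemma sum_indicator_powr_le:
  fixes a :: "(real^'n) set \<Rightarrow> real"
  assumes fin: "finite \<S>" and q: "1 \<le> q" and a: "\<And>S. S \<in> \<S> \<Longrightarrow> 0 \<le> a S"
  defines "B \<equiv> \<lambda>S. \<Sum>R\<in>{R\<in>\<S>. S \<subseteq> R}. a R"
  shows "(\<Sum>S\<in>\<S>. a S * indicator S x) powr q
    \<le> (\<Sum>S\<in>\<S>. ((2 * q) powr (q - 1) * a S powr q + (q - 1) / (2 * q) * B S powr q) * indicator S x)"
proof -
  define G where "G = {S\<in>\<S>. x \<in> S}"
  have G: "finite G" "G \<subseteq> \<S>" using fin by (auto simp: G_def)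
  have restrict: "(\<Sum>S\<in>\<S>. b S * indicator S x) = (\<Sum>S\<in>G. b S)" for b :: "(real^'n) set \<Rightarrow> real"
  proof -
    have "(\<Sum>S\<in>\<S>. b S * indicator S x) = (\<Sum>S\<in>\<S>. if x \<in> S then b S else 0)"
      by (intro sum.cong) (auto simp: indicator_def)
    then show ?thesis unfolding G_def using fin by (simp only: sum.inter_filter)
  qed
  \<comment> \<open>Every cube containing \<open>S\<close> also contains \<open>x\<close>, so the
    inner sum over the chain does not depend on \<open>x\<close>.\<close>
  have B: "(\<Sum>R\<in>{R\<in>G. S \<subseteq> R}. a R) = B S" if "S \<in> G" for S
    unfolding B_def using that by (intro sum.cong) (auto simp: G_def)
  have "(\<Sum>S\<in>G. a S) powr q \<le> (\<Sum>S\<in>G. q * a S * (\<Sum>R\<in>{R\<in>G. S \<subseteq> R}. a R) powr (q - 1))"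
  proof (rule powr_chain_sum_le[OF q G(1)])
    show "S \<subseteq> T \<or> T \<subseteq> S" if "S \<in> G" "T \<in> G" for S T
      using that nested[of S T x] by (auto simp: G_def)
  qed (use a G in auto)
  also have "\<dots> = (\<Sum>S\<in>G. q * a S * B S powr (q - 1))"
    by (intro sum.cong refl) (simp only: B)
  also have "\<dots> \<le> (\<Sum>S\<in>G. (2 * q) powr (q - 1) * a S powr q + (q - 1) / (2 * q) * B S powr q)"
  proof (intro sum_mono)
    fix S assume "S \<in> G"
    moreover have "0 \<le> B S" unfolding B_def using a by (intro sum_nonneg) auto
    ultimately show "q * a S * B S powr (q - 1)
        \<le> (2 * q) powr (q - 1) * a S powr q + (q - 1) / (2 * q) * B S powr q"
      using G a by (intro Young_chain q) auto
  qed
  finally show ?thesis by (simp add: restrict)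
qed

text \<open>The sets \<open>E_part\<close> are pairwise disjoint, so at most one term on the left
  survives at \<open>x\<close>. For that cube \<open>S\<close>, all \<open>R\<close> above
  \<open>S\<close> contain \<open>x\<close>, and their coefficients form part of the sum on the
  right.\<close>

lemma sum_E_part_powr_le:
  fixes a :: "(real^'n) set \<Rightarrow> real"
  assumes fin: "finite \<S>" and q: "0 \<le> q" and a: "\<And>S. S \<in> \<S> \<Longrightarrow> 0 \<le> a S"
  shows "(\<Sum>S\<in>\<S>. (\<Sum>R\<in>{R\<in>\<S>. S \<subseteq> R}. a R) powr q * indicator (E_part \<S> S) x)
    \<le> (\<Sum>S\<in>\<S>. a S * indicator S x) powr q"
proof (cases "\<exists>S\<in>\<S>. x \<in> E_part \<S> S")
  case True
  then obtain S where S: "S \<in> \<S>" "x \<in> E_part \<S> S" by auto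
  let ?b = "\<lambda>S. (\<Sum>R\<in>{R\<in>\<S>. S \<subseteq> R}. a R) powr q * indicator (E_part \<S> S) x"
  have "?b T = 0" if "T \<in> \<S> - {S}" for T
    using that S E_part_disjoint[of S T x] by (auto simp: indicator_def)
  then have "(\<Sum>T\<in>\<S> - {S}. ?b T) = 0" by (rule sum.neutral[OF ballI])
  then have "(\<Sum>T\<in>\<S>. ?b T) = ?b S"
    using sum.remove[OF fin S(1), of ?b] by simp
  also have "\<dots> = (\<Sum>R\<in>{R\<in>\<S>. S \<subseteq> R}. a R * indicator R x) powr q"
  proof -
    have "(\<Sum>R\<in>{R\<in>\<S>. S \<subseteq> R}. a R) = (\<Sum>R\<in>{R\<in>\<S>. S \<subseteq> R}. a R * indicator R x)"
      using S E_part_subset by (intro sum.cong) (auto simp: indicator_def)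
    then show ?thesis using S by simp
  qed
  also have "\<dots> \<le> (\<Sum>S\<in>\<S>. a S * indicator S x) powr q"
    using fin q a by (intro powr_mono2 sum_mono2 sum_nonneg mult_nonneg_nonneg) auto
  finally show ?thesis .
qed (simp add: indicator_def)

text \<open>Integrating the pointwise bound gives \<open>X \<le> c * Y + d * W\<close>, where
  \<open>W\<close> sums \<open>B S powr q\<close> against the measures of the cubes, and sparseness
  gives \<open>W \<le> 2 * X\<close>. Since \<open>2 * d = (q - 1) / q\<close>, the \<open>W\<close>
  term is absorbed on the left, leaving \<open>X \<le> q * c * Y\<close>.\<close>

lemma nn_integral_sum_indicator_powr_le:
  fixes a :: "(real^'n) set \<Rightarrow> real"
  assumes fin: "finite \<S>" and q: "1 \<le> q" and a: "\<And>S. S \<in> \<S> \<Longrightarrow> 0 \<le> a S"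
  shows "(\<integral>\<^sup>+x. ennreal ((\<Sum>S\<in>\<S>. a S * indicator S x) powr q) \<partial>\<mu>)
    \<le> ennreal (2 powr (q - 1) * q powr q) * (\<Sum>S\<in>\<S>. ennreal (a S powr q) * emeasure \<mu> S)"
    (is "?X \<le> _ * ?Y")
proof (cases "?Y = top")
  case True
  then show ?thesis using q by (simp add: ennreal_mult_top)
next
  case Y: False
  define B where "B = (\<lambda>S. \<Sum>R\<in>{R\<in>\<S>. S \<subseteq> R}. a R)"
  define c where "c = (2 * q) powr (q - 1)"
  define d where "d = (q - 1) / (2 * q)"
  have cd: "0 \<le> c" "0 \<le> d" using q by (auto simp: c_def d_def)
  let ?W = "\<Sum>S\<in>\<S>. ennreal (B S powr q) * emeasure \<mu> S"
  have "?X \<le> (\<integral>\<^sup>+x. (\<Sum>S\<in>\<S>. ennreal (c * a S powr q + d * B S powr q) * indicator S x) \<partial>\<mu>)"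
  proof (intro nn_integral_mono)
    fix x
    have "ennreal ((\<Sum>S\<in>\<S>. a S * indicator S x) powr q)
        \<le> ennreal (\<Sum>S\<in>\<S>. (c * a S powr q + d * B S powr q) * indicator S x)"
      unfolding c_def d_def B_def by (intro ennreal_leI sum_indicator_powr_le fin q a)
    also have "\<dots> = (\<Sum>S\<in>\<S>. ennreal (c * a S powr q + d * B S powr q) * indicator S x)"
      using cd by (subst sum_ennreal_indicator) auto
    finally show "ennreal ((\<Sum>S\<in>\<S>. a S * indicator S x) powr q)
        \<le> (\<Sum>S\<in>\<S>. ennreal (c * a S powr q + d * B S powr q) * indicator S x)" .
  qed
  also have "\<dots> = (\<Sum>S\<in>\<S>. ennreal (c * a S powr q + d * B S powr q) * emeasure \<mu> S)"
    by (subst nn_integral_sum) (auto simp: nn_integral_cmult_indicator intro!: sum.cong)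
  also have "\<dots> = ennreal c * ?Y + ennreal d * ?W"
    using cd
    by (simp add: ennreal_plus ennreal_mult distrib_right sum.distrib sum_distrib_left mult.assoc)
  finally have X_le: "?X \<le> ennreal c * ?Y + ennreal d * ?W" .
  have "?W \<le> (\<Sum>S\<in>\<S>. ennreal (B S powr q) * (2 * emeasure \<mu> (E_part \<S> S)))"
    by (intro sum_mono mult_left_mono emeasure_cube_le) auto
  also have "\<dots> = 2 * (\<integral>\<^sup>+x. (\<Sum>S\<in>\<S>. ennreal (B S powr q) * indicator (E_part \<S> S) x) \<partial>\<mu>)"
    by (subst nn_integral_sum)
      (auto simp: nn_integral_cmult_indicator sum_distrib_left mult.left_commute intro!: sum.cong)
  also have "\<dots> \<le> 2 * ?X"
  proof (intro mult_left_mono nn_integral_mono)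
    fix x
    have "(\<Sum>S\<in>\<S>. ennreal (B S powr q) * indicator (E_part \<S> S) x)
        = ennreal (\<Sum>S\<in>\<S>. B S powr q * indicator (E_part \<S> S) x)"
      by (rule sum_ennreal_indicator) simp
    also have "\<dots> \<le> ennreal ((\<Sum>S\<in>\<S>. a S * indicator S x) powr q)"
      unfolding B_def using q by (intro ennreal_leI sum_E_part_powr_le fin a) auto
    finally show "(\<Sum>S\<in>\<S>. ennreal (B S powr q) * indicator (E_part \<S> S) x)
        \<le> ennreal ((\<Sum>S\<in>\<S>. a S * indicator S x) powr q)" .
  qed simp
  finally have W_le: "?W \<le> 2 * ?X" .
  \<comment> \<open>Absorption needs \<open>?X\<close> to be finite. As \<open>?Y\<close> is finite,
    cubes with \<open>a S \<noteq> 0\<close> have finite measure, hence so do all cubes with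
    \<open>B S \<noteq> 0\<close>, which lie in such cubes; thus \<open>?W\<close> and then
    \<open>?X\<close> are finite.\<close>
  have fin_a: "emeasure \<mu> S < top" if "S \<in> \<S>" "a S \<noteq> 0" for S
  proof -
    have "ennreal (a S powr q) * emeasure \<mu> S \<noteq> top"
      using Y that fin by (auto simp: less_top)
    moreover have "ennreal (a S powr q) \<noteq> 0" using that a by (simp add: ennreal_eq_0_iff)
    ultimately show ?thesis by (auto simp: ennreal_mult_eq_top_iff less_top)
  qed
  have "ennreal (B S powr q) * emeasure \<mu> S < top" if S: "S \<in> \<S>" for S
  proof (cases "B S = 0")
    case False
    then obtain R where R: "R \<in> \<S>" "S \<subseteq> R" "a R \<noteq> 0"
      unfolding B_def by (metis (no_types, lifting) mem_Collect_eq sum.neutral)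
    then have "emeasure \<mu> S \<le> emeasure \<mu> R" by (intro emeasure_mono) auto
    then have "emeasure \<mu> S < top" using fin_a[OF R(1,3)] by (rule order_le_less_trans)
    then show ?thesis by (simp add: ennreal_mult_less_top)
  qed simp
  then have "?W < top" using fin by simp
  then have "ennreal c * ?Y + ennreal d * ?W < top"
    using Y by (auto simp: ennreal_mult_less_top less_top)
  with X_le have "?X < top" by (rule order_le_less_trans)
  then obtain x where x: "0 \<le> x" "?X = ennreal x" by (cases ?X) auto
  obtain y where y: "0 \<le> y" "?Y = ennreal y" using Y by (cases ?Y) auto
  have "ennreal x \<le> ennreal c * ?Y + ennreal d * (2 * ?X)"
    using X_le mult_left_mono[OF W_le, of "ennreal d"] x
    by (metis (no_types, lifting) add_left_mono order_trans zero_le)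
  also have "\<dots> = ennreal (c * y + d * (2 * x))"
    using x y cd by (simp add: ennreal_mult ennreal_plus)
  finally have "x \<le> c * y + d * (2 * x)"
    using x y cd by (subst (asm) ennreal_le_iff) auto
  moreover have "q * (d * (2 * x)) = (q - 1) * x" using q by (simp add: d_def)
  ultimately have "x \<le> q * c * y"
    using mult_left_mono[of x "c * y + d * (2 * x)" q] q by (simp add: algebra_simps)
  also have "q * c = 2 powr (q - 1) * q powr q"
    using q by (simp add: c_def powr_mult powr_diff)
  finally have "x \<le> 2 powr (q - 1) * q powr q * y" .
  then have "ennreal x \<le> ennreal (2 powr (q - 1) * q powr q * y)" by (rule ennreal_leI)
  also have "\<dots> = ennreal (2 powr (q - 1) * q powr q) * ennreal y"
    using y by (intro ennreal_mult) auto
  finally show ?thesis by (simp only: x y)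
qed

text \<open>This is dual to the previous estimate: test \<open>H\<close> against \<open>\<Sum>\<^sub>S U\<^sub>S\<^bsup>p - 1\<^esup> 1\<^sub>S\<close>.\<close>

lemma Carleson_embedding:
  assumes fin: "finite \<S>" and p: "1 < p"
    and H: "\<And>x. 0 \<le> H x" and H_meas [measurable]: "H \<in> borel_measurable \<mu>"
    and U: "\<And>S. S \<in> \<S> \<Longrightarrow> 0 \<le> U S"
    and avg: "\<And>S. S \<in> \<S> \<Longrightarrow> ennreal (U S) * emeasure \<mu> S \<le> (\<integral>\<^sup>+x. ennreal (H x) * indicator S x \<partial>\<mu>)"
    and inf: "\<And>S. S \<in> \<S> \<Longrightarrow> emeasure \<mu> S = top \<Longrightarrow> U S = 0"
  shows "(\<Sum>S\<in>\<S>. ennreal (U S powr p) * emeasure \<mu> S)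
    \<le> ennreal (2 * (p / (p - 1)) powr p) * (\<integral>\<^sup>+x. ennreal (H x powr p) \<partial>\<mu>)"
    (is "?Z \<le> _ * ?I")
proof (cases "?I = top")
  case True
  then show ?thesis using p by (simp add: ennreal_mult_top)
next
  case False
  then obtain i where i: "0 \<le> i" "?I = ennreal i" by (cases ?I) auto
  define q where "q = p / (p - 1)"
  \<comment> \<open>The scaling in Young's inequality below: \<open>l powr q\<close> equals the
    constant of the dual estimate, so the dual term becomes exactly \<open>z / q\<close>, while
    \<open>l powr p = 2 * q powr p\<close> gives the final constant.\<close>
  define l where "l = 2 powr (1 / p) * q"
  have q: "1 < q" "1 / p + 1 / q = 1" "(p - 1) * q = p" "q / p = q - 1"
    using p by (auto simp: q_def field_simps)
  have l: "0 < l" "l powr p = 2 * q powr p" "l powr q = 2 powr (q - 1) * q powr q"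
    using p q by (simp_all add: l_def powr_mult powr_powr)
  \<comment> \<open>Finiteness of \<open>?Z\<close>, which rests on \<open>U S = 0\<close> for cubes
    of infinite measure, permits subtracting \<open>z / q\<close> at the end.\<close>
  have "ennreal (U S powr p) * emeasure \<mu> S < top" if "S \<in> \<S>" for S
    using inf[OF that] by (cases "emeasure \<mu> S = top") (auto simp: ennreal_mult_less_top less_top)
  then have "?Z \<noteq> top" using fin by (simp add: less_top)
  then obtain z where z: "0 \<le> z" "?Z = ennreal z" by (cases ?Z) auto
  have lincomb: "ennreal a * ennreal i + ennreal b * (ennreal c * ennreal z) = ennreal (a * i + b * (c * z))"
    if "0 \<le> a" "0 \<le> b" "0 \<le> c" "0 \<le> i" "0 \<le> z" for a b c i z
    using that by (simp add: ennreal_mult)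
  let ?G = "\<lambda>x. \<Sum>S\<in>\<S>. U S powr (p - 1) * indicator S x"
  have "?Z \<le> (\<Sum>S\<in>\<S>. ennreal (U S powr (p - 1)) * (\<integral>\<^sup>+x. ennreal (H x) * indicator S x \<partial>\<mu>))"
  proof (intro sum_mono)
    fix S assume S: "S \<in> \<S>"
    have "U S powr p = U S powr (p - 1) * U S"
      using U[OF S] by (cases "U S = 0") (simp_all add: powr_diff)
    then have "ennreal (U S powr p) * emeasure \<mu> S
        = ennreal (U S powr (p - 1)) * (ennreal (U S) * emeasure \<mu> S)"
      using U[OF S] by (simp add: ennreal_mult mult.assoc)
    also have "\<dots> \<le> ennreal (U S powr (p - 1)) * (\<integral>\<^sup>+x. ennreal (H x) * indicator S x \<partial>\<mu>)"
      by (intro mult_left_mono avg S) simp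
    finally show "ennreal (U S powr p) * emeasure \<mu> S
        \<le> ennreal (U S powr (p - 1)) * (\<integral>\<^sup>+x. ennreal (H x) * indicator S x \<partial>\<mu>)" .
  qed
  also have "\<dots> = (\<integral>\<^sup>+x. (\<Sum>S\<in>\<S>. ennreal (U S powr (p - 1)) * (ennreal (H x) * indicator S x)) \<partial>\<mu>)"
    by (subst nn_integral_sum) (auto simp: nn_integral_cmult intro!: sum.cong)
  also have "\<dots> \<le> (\<integral>\<^sup>+x. ennreal (l powr p / p) * ennreal (H x powr p)
      + ennreal (1 / (q * l powr q)) * ennreal (?G x powr q) \<partial>\<mu>)"
  proof (intro nn_integral_mono)
    fix x
    have "(\<Sum>S\<in>\<S>. ennreal (U S powr (p - 1)) * (ennreal (H x) * indicator S x))
        = (\<Sum>S\<in>\<S>. ennreal (U S powr (p - 1) * indicator S x * H x))"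
      using H[of x] by (intro sum.cong) (auto simp: indicator_def ennreal_mult)
    also have "\<dots> = ennreal (?G x * H x)"
      using H[of x] by (subst sum_ennreal) (auto simp: sum_distrib_right)
    also have "\<dots> = ennreal ((l * H x) * (?G x / l))"
      using l by (simp add: mult.commute)
    also have "\<dots> \<le> ennreal ((l * H x) powr p / p + (?G x / l) powr q / q)"
      using p q l H[of x] by (intro ennreal_leI Youngs_inequality) (auto intro!: sum_nonneg divide_nonneg_nonneg)
    also have "(l * H x) powr p / p + (?G x / l) powr q / q
        = l powr p / p * H x powr p + 1 / (q * l powr q) * ?G x powr q"
      using l H[of x] by (simp add: powr_mult powr_divide sum_nonneg)
    also have "ennreal \<dots> = ennreal (l powr p / p) * ennreal (H x powr p)
      + ennreal (1 / (q * l powr q)) * ennreal (?G x powr q)"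
      using p q by (simp add: ennreal_mult[symmetric] ennreal_plus[symmetric] del: ennreal_plus)
    finally show "(\<Sum>S\<in>\<S>. ennreal (U S powr (p - 1)) * (ennreal (H x) * indicator S x))
      \<le> ennreal (l powr p / p) * ennreal (H x powr p)
      + ennreal (1 / (q * l powr q)) * ennreal (?G x powr q)" .
  qed
  also have "\<dots> = ennreal (l powr p / p) * ?I
      + ennreal (1 / (q * l powr q)) * (\<integral>\<^sup>+x. ennreal (?G x powr q) \<partial>\<mu>)"
    by (simp add: nn_integral_add nn_integral_cmult)
  also have "\<dots> \<le> ennreal (l powr p / p) * ?I
      + ennreal (1 / (q * l powr q)) * (ennreal (2 powr (q - 1) * q powr q) *
          (\<Sum>S\<in>\<S>. ennreal ((U S powr (p - 1)) powr q) * emeasure \<mu> S))"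
    using q by (intro add_left_mono mult_left_mono nn_integral_sum_indicator_powr_le fin) auto
  \<comment> \<open>Since \<open>(p - 1) * q = p\<close>, the sum produced by the dual estimate is
    \<open>?Z\<close> again.\<close>
  also have "\<dots> = ennreal (l powr p / p) * ennreal i
      + ennreal (1 / (q * l powr q)) * (ennreal (2 powr (q - 1) * q powr q) * ennreal z)"
    by (simp only: powr_powr q(3) i z)
  also have "\<dots> = ennreal (l powr p / p * i + 1 / (q * l powr q) * (2 powr (q - 1) * q powr q * z))"
    using i(1) z(1) p q(1) by (intro lincomb) auto
  also have "l powr p / p * i + 1 / (q * l powr q) * (2 powr (q - 1) * q powr q * z)
      = 2 * q powr p / p * i + z / q"
    using l q by simp
  finally have "z \<le> 2 * q powr p / p * i + z / q"
    using z i p q by (subst (asm) z(2), subst (asm) ennreal_le_iff) auto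
  then have "z * (1 - 1 / q) \<le> 2 * q powr p / p * i" by (simp add: algebra_simps)
  also have "1 - 1 / q = 1 / p" using q(2) by simp
  finally have "z \<le> 2 * q powr p * i" using p by (simp add: field_simps)
  then have "ennreal z \<le> ennreal (2 * q powr p * i)" by (rule ennreal_leI)
  also have "\<dots> = ennreal (2 * q powr p) * ennreal i"
    using i by (intro ennreal_mult) auto
  finally show ?thesis by (simp only: i z q_def)
qed

end

section \<open>Estimates for finite collections\<close>

lemma powr_mult_indicator:
  fixes a p :: real
  shows "p \<noteq> 0 \<Longrightarrow> (a * indicator A x) powr p = a powr p * indicator A x"
  by (cases "x \<in> A") auto

context sparse_dyadic
begin

text \<open>A value that is constant on a cube is read off at one chosen point, which makes the
  coefficients below independent of \<open>x\<close>.\<close>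

definition pt :: "(real^'n) set \<Rightarrow> real^'n" where
  "pt S = (SOME x. x \<in> S)"

lemma pt_mem: "S \<in> \<S> \<Longrightarrow> pt S \<in> S"
  unfolding pt_def using cube_nonempty by (metis some_in_eq)

text \<open>A cube is the disjoint union of \<open>E_part\<close> and its children, the latter being
  pairwise disjoint by maximality.\<close>

lemma indicator_split:
  assumes fin: "finite \<S>" and S: "S \<in> \<S>"
  shows "(indicator S x :: real) = indicator (E_part \<S> S) x + (\<Sum>T\<in>ch \<S> S. indicator T x)"
proof (cases "\<exists>T\<in>ch \<S> S. x \<in> T")
  case True
  then obtain T where T: "T \<in> ch \<S> S" "x \<in> T" by auto
  have "finite (ch \<S> S)" using fin by (auto simp: ch_def)
  moreover have "(\<Sum>T'\<in>ch \<S> S - {T}. indicator T' x :: real) = 0"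
    using T ch_disjoint by (intro sum.neutral) (auto simp: indicator_def)
  ultimately have "(\<Sum>T\<in>ch \<S> S. indicator T x :: real) = 1"
    using T by (simp add: sum.remove[of _ T])
  moreover have "x \<in> S" using T chD by blast
  moreover have "x \<notin> E_part \<S> S" using T by (auto simp: E_part_def)
  ultimately show ?thesis by simp
next
  case False
  then have "(\<Sum>T\<in>ch \<S> S. indicator T x :: real) = 0" by (intro sum.neutral) auto
  then show ?thesis using False by (auto simp: E_part_def indicator_def)
qed

lemma sum_ch_indicator_le_1:
  assumes "finite \<S>" and "S \<in> \<S>"
  shows "(\<Sum>T\<in>ch \<S> S. indicator T x) \<le> (1::real)"
proof -
  have "(indicator S x :: real) \<le> 1" "0 \<le> (indicator (E_part \<S> S) x :: real)"
    by (auto simp: indicator_def)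
  then show ?thesis using indicator_split[OF assms, of x] by linarith
qed

text \<open>Pairs of parent and child are grouped by the child instead of the parent; each inner
  group on the right then has at most one element.\<close>

lemma sum_ch_swap:
  assumes "finite \<S>"
  shows "(\<Sum>S\<in>\<S>. \<Sum>T\<in>ch \<S> S. b S T) = (\<Sum>T\<in>\<S>. \<Sum>S\<in>{S\<in>\<S>. T \<in> ch \<S> S}. b S T)"
proof -
  have "ch \<S> S = {T\<in>\<S>. T \<in> ch \<S> S}" for S by (auto simp: ch_def)
  then have "(\<Sum>S\<in>\<S>. \<Sum>T\<in>ch \<S> S. b S T) = (\<Sum>S\<in>\<S>. \<Sum>T\<in>{T\<in>\<S>. T \<in> ch \<S> S}. b S T)" by simp
  then show ?thesis using sum.swap_restrict[OF assms assms] by simp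
qed

lemma adapted_measurable: "adapted \<mu> \<S> f \<Longrightarrow> S \<in> \<S> \<Longrightarrow> strongly_measurable \<mu> (f S)"
  by (simp add: adapted_def)

lemma adapted_outside: "adapted \<mu> \<S> f \<Longrightarrow> S \<in> \<S> \<Longrightarrow> x \<notin> S \<Longrightarrow> f S x = 0"
  by (simp add: adapted_def)

lemma adapted_eq_pt:
  "adapted \<mu> \<S> f \<Longrightarrow> S \<in> \<S> \<Longrightarrow> R \<in> \<S> \<Longrightarrow> R \<subset> S \<Longrightarrow> x \<in> R \<Longrightarrow> f S x = f S (pt R)"
  using adapted_eq pt_mem by blast

text \<open>The norms stand inside the power so that the bound also yields absolute convergence of
  infinite series. The parts on the sets \<open>E_part\<close> have disjoint supports; the parts on
  the children form a sum of multiples of indicators of cubes.\<close>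

lemma nn_integral_sum_norm_powr_le:
  fixes f :: "(real^'n) set \<Rightarrow> real^'n \<Rightarrow> 'e::real_normed_vector"
  assumes fin: "finite \<S>" and p: "1 \<le> p" and f: "adapted \<mu> \<S> f"
  shows "(\<integral>\<^sup>+x. ennreal ((\<Sum>S\<in>\<S>. norm (f S x)) powr p) \<partial>\<mu>)
    \<le> ennreal ((3 * p) powr p) * (\<Sum>S\<in>\<S>. \<integral>\<^sup>+x. ennreal (norm (f S x) powr p) \<partial>\<mu>)"
    (is "_ \<le> _ * ?N")
proof -
  \<comment> \<open>By uniqueness of parents this sum has at most one term: the norm taken on
    \<open>T\<close> by the function of the parent of \<open>T\<close>.\<close>
  define a where "a T = (\<Sum>S\<in>{S\<in>\<S>. T \<in> ch \<S> S}. norm (f S (pt T)))" for T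
  define \<psi> where "\<psi> x = (\<Sum>S\<in>\<S>. norm (f S x) * indicator (E_part \<S> S) x)" for x
  have meas [measurable]: "(\<lambda>x. norm (f S x)) \<in> borel_measurable \<mu>" if "S \<in> \<S>" for S
    using adapted_measurable[OF f that] by (rule borel_measurable_norm_strongly_measurable)
  have \<psi>_meas [measurable]: "\<psi> \<in> borel_measurable \<mu>" unfolding \<psi>_def by measurable
  have const: "norm (f S x) * indicator T x = norm (f S (pt T)) * indicator T x"
    if "S \<in> \<S>" "T \<in> ch \<S> S" for S T x
    using adapted_eq_pt[OF f that(1), of T x] chD[OF that(2)] by (cases "x \<in> T") auto
  have split: "norm (f S x) = norm (f S x) * indicator (E_part \<S> S) x
      + (\<Sum>T\<in>ch \<S> S. norm (f S (pt T)) * indicator T x)" if S: "S \<in> \<S>" for S x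
  proof -
    have "norm (f S x) = norm (f S x) * indicator S x"
      using adapted_outside[OF f S, of x] by (cases "x \<in> S") auto
    also have "\<dots> = norm (f S x) * indicator (E_part \<S> S) x
        + (\<Sum>T\<in>ch \<S> S. norm (f S x) * indicator T x)"
      by (simp add: indicator_split[OF fin S] distrib_left sum_distrib_left)
    also have "(\<Sum>T\<in>ch \<S> S. norm (f S x) * indicator T x)
        = (\<Sum>T\<in>ch \<S> S. norm (f S (pt T)) * indicator T x)"
      by (intro sum.cong refl const S)
    finally show ?thesis .
  qed
  have total: "(\<Sum>S\<in>\<S>. norm (f S x)) = \<psi> x + (\<Sum>T\<in>\<S>. a T * indicator T x)" for x
  proof -
    have "(\<Sum>S\<in>\<S>. norm (f S x)) = (\<Sum>S\<in>\<S>. norm (f S x) * indicator (E_part \<S> S) x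
        + (\<Sum>T\<in>ch \<S> S. norm (f S (pt T)) * indicator T x))"
      by (intro sum.cong refl split)
    also have "\<dots> = \<psi> x + (\<Sum>S\<in>\<S>. \<Sum>T\<in>ch \<S> S. norm (f S (pt T)) * indicator T x)"
      by (simp add: \<psi>_def sum.distrib)
    finally show ?thesis by (simp add: sum_ch_swap[OF fin] a_def sum_distrib_right)
  qed
  have "(\<integral>\<^sup>+x. ennreal ((\<Sum>S\<in>\<S>. norm (f S x)) powr p) \<partial>\<mu>)
      \<le> (\<integral>\<^sup>+x. ennreal (3 powr (p - 1)) * ennreal (\<psi> x powr p)
          + ennreal ((3 / 2) powr (p - 1)) * ennreal ((\<Sum>T\<in>\<S>. a T * indicator T x) powr p) \<partial>\<mu>)"
  proof (intro nn_integral_mono)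
    fix x
    have nn: "0 \<le> \<psi> x" "0 \<le> (\<Sum>T\<in>\<S>. a T * indicator T x :: real)"
      unfolding \<psi>_def a_def by (auto intro!: sum_nonneg mult_nonneg_nonneg)
    \<comment> \<open>The weight \<open>2 / 3\<close> balances the two parts:
      \<open>(3 / 2) powr (p - 1)\<close> times the factor \<open>2 powr (p - 1)\<close> from the
      indicator estimate is \<open>3 powr (p - 1)\<close>, the factor of the first part.\<close>
    have "(\<Sum>S\<in>\<S>. norm (f S x)) powr p \<le> (1 / 3) powr (1 - p) * \<psi> x powr p
        + (2 / 3) powr (1 - p) * (\<Sum>T\<in>\<S>. a T * indicator T x) powr p"
      using powr_add_weighted_le[OF p nn, of "2 / 3"] by (simp add: total)
    also have "(1 / 3 :: real) powr (1 - p) = 3 powr (p - 1)"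
      by (simp add: powr_divide powr_diff field_simps)
    also have "(2 / 3 :: real) powr (1 - p) = (3 / 2) powr (p - 1)"
      by (simp add: powr_divide powr_diff field_simps)
    finally show "ennreal ((\<Sum>S\<in>\<S>. norm (f S x)) powr p) \<le> ennreal (3 powr (p - 1)) * ennreal (\<psi> x powr p)
          + ennreal ((3 / 2) powr (p - 1)) * ennreal ((\<Sum>T\<in>\<S>. a T * indicator T x) powr p)"
      by (simp add: ennreal_leI flip: ennreal_mult ennreal_plus)
  qed
  also have "\<dots> = ennreal (3 powr (p - 1)) * (\<integral>\<^sup>+x. ennreal (\<psi> x powr p) \<partial>\<mu>)
      + ennreal ((3 / 2) powr (p - 1)) * (\<integral>\<^sup>+x. ennreal ((\<Sum>T\<in>\<S>. a T * indicator T x) powr p) \<partial>\<mu>)"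
    by (simp add: nn_integral_add nn_integral_cmult)
  also have "\<dots> \<le> ennreal (3 powr (p - 1)) * ?N
      + ennreal ((3 / 2) powr (p - 1)) * (ennreal (2 powr (p - 1) * p powr p) * ?N)"
  proof (intro add_mono mult_left_mono)
    have "(\<integral>\<^sup>+x. ennreal (\<psi> x powr p) \<partial>\<mu>) \<le> (\<integral>\<^sup>+x. (\<Sum>S\<in>\<S>. ennreal (norm (f S x) powr p)) \<partial>\<mu>)"
    proof (intro nn_integral_mono)
      fix x
      have "\<psi> x powr p = (\<Sum>S\<in>\<S>. (norm (f S x) * indicator (E_part \<S> S) x) powr p)"
        unfolding \<psi>_def
        by (rule sum_powr_eq_powr_sum[OF fin]) (auto simp: indicator_def dest: E_part_disjoint split: if_splits)
      also have "\<dots> \<le> (\<Sum>S\<in>\<S>. norm (f S x) powr p)"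
        using p by (intro sum_mono powr_mono2) (auto simp: indicator_def)
      finally show "ennreal (\<psi> x powr p) \<le> (\<Sum>S\<in>\<S>. ennreal (norm (f S x) powr p))"
        by (subst sum_ennreal) (auto intro: ennreal_leI)
    qed
    also have "\<dots> = ?N" by (rule nn_integral_sum) measurable
    finally show "(\<integral>\<^sup>+x. ennreal (\<psi> x powr p) \<partial>\<mu>) \<le> ?N" .
  next
    have "(\<integral>\<^sup>+x. ennreal ((\<Sum>T\<in>\<S>. a T * indicator T x) powr p) \<partial>\<mu>)
        \<le> ennreal (2 powr (p - 1) * p powr p) * (\<Sum>T\<in>\<S>. ennreal (a T powr p) * emeasure \<mu> T)"
      by (intro nn_integral_sum_indicator_powr_le fin p) (auto simp: a_def intro!: sum_nonneg)
    \<comment> \<open>Grouped by parents, the terms belonging to \<open>S\<close> integrate the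
      \<open>p\<close>-th power of the norm of \<open>f S\<close> over its disjoint children
      only.\<close>
    also have "(\<Sum>T\<in>\<S>. ennreal (a T powr p) * emeasure \<mu> T) \<le> ?N"
    proof -
      have "a T powr p = (\<Sum>S\<in>{S\<in>\<S>. T \<in> ch \<S> S}. norm (f S (pt T)) powr p)" for T
        unfolding a_def using fin parent_unique by (intro sum_powr_eq_powr_sum) auto
      then have "(\<Sum>T\<in>\<S>. ennreal (a T powr p) * emeasure \<mu> T)
          = (\<Sum>S\<in>\<S>. \<Sum>T\<in>ch \<S> S. ennreal (norm (f S (pt T)) powr p) * emeasure \<mu> T)"
        by (simp add: sum_ch_swap[OF fin] sum_distrib_right flip: sum_ennreal)
      also have "\<dots> \<le> ?N"
      proof (intro sum_mono)
        fix S assume S: "S \<in> \<S>"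
        have T_meas: "T \<in> sets \<mu>" if "T \<in> ch \<S> S" for T using chD[OF that] by auto
        have "(\<Sum>T\<in>ch \<S> S. ennreal (norm (f S (pt T)) powr p) * emeasure \<mu> T)
            = (\<integral>\<^sup>+x. (\<Sum>T\<in>ch \<S> S. ennreal (norm (f S (pt T)) powr p) * indicator T x) \<partial>\<mu>)"
          using T_meas by (subst nn_integral_sum) (auto simp: nn_integral_cmult_indicator)
        also have "\<dots> \<le> (\<integral>\<^sup>+x. ennreal (norm (f S x) powr p) \<partial>\<mu>)"
        proof (intro nn_integral_mono)
          fix x
          have "(\<Sum>T\<in>ch \<S> S. norm (f S (pt T)) powr p * indicator T x)
              = (\<Sum>T\<in>ch \<S> S. norm (f S x) powr p * indicator T x)"
          proof (intro sum.cong refl)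
            fix T assume "T \<in> ch \<S> S"
            from const[OF S this, of x]
            show "norm (f S (pt T)) powr p * indicator T x = norm (f S x) powr p * indicator T x"
              by (cases "x \<in> T") auto
          qed
          also have "\<dots> = norm (f S x) powr p * (\<Sum>T\<in>ch \<S> S. indicator T x)"
            by (simp add: sum_distrib_left)
          also have "\<dots> \<le> norm (f S x) powr p * 1"
            by (intro mult_left_mono sum_ch_indicator_le_1 fin S) simp
          finally show "(\<Sum>T\<in>ch \<S> S. ennreal (norm (f S (pt T)) powr p) * indicator T x)
              \<le> ennreal (norm (f S x) powr p)"
            by (subst sum_ennreal_indicator) (auto intro: ennreal_leI)
        qed
        finally show "(\<Sum>T\<in>ch \<S> S. ennreal (norm (f S (pt T)) powr p) * emeasure \<mu> T)
            \<le> (\<integral>\<^sup>+x. ennreal (norm (f S x) powr p) \<partial>\<mu>)" .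
      qed
      finally show ?thesis .
    qed
    finally show "(\<integral>\<^sup>+x. ennreal ((\<Sum>T\<in>\<S>. a T * indicator T x) powr p) \<partial>\<mu>)
        \<le> ennreal (2 powr (p - 1) * p powr p) * ?N"
      by (simp add: mult_left_mono)
  qed simp_all
  also have "\<dots> = ennreal (3 powr (p - 1) + (3 / 2) powr (p - 1) * (2 powr (p - 1) * p powr p)) * ?N"
    by (simp add: ennreal_mult distrib_right mult.assoc)
  also have "\<dots> \<le> ennreal ((3 * p) powr p) * ?N"
  proof (intro mult_right_mono ennreal_leI)
    have "(3 / 2) powr (p - 1) * 2 powr (p - 1) = (3::real) powr (p - 1)"
      by (simp flip: powr_mult)
    then have "3 powr (p - 1) + (3 / 2) powr (p - 1) * (2 powr (p - 1) * p powr p)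
        = 3 powr (p - 1) * (1 + p powr p)"
      by (simp add: distrib_left flip: mult.assoc)
    also have "\<dots> \<le> 3 powr (p - 1) * (3 * p powr p)"
      using ge_one_powr_ge_zero[OF p, of p] p by (intro mult_left_mono) auto
    also have "\<dots> = (3 * p) powr p" using p by (simp add: powr_mult powr_diff)
    finally show "3 powr (p - 1) + (3 / 2) powr (p - 1) * (2 powr (p - 1) * p powr p) \<le> (3 * p) powr p" .
  qed simp
  finally show ?thesis .
qed

section \<open>Mean-zero families: contributions of the larger cubes and their role as
  averages\<close>

definition ancestor_sum :: "((real^'n) set \<Rightarrow> real^'n \<Rightarrow> 'e::real_normed_vector) \<Rightarrow> (real^'n) set \<Rightarrow> 'e" where
  "ancestor_sum f S = (\<Sum>R\<in>{R\<in>\<S>. S \<subset> R}. f R (pt S))"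

text \<open>Each strictly larger cube carries a function that is constant on \<open>S\<close>, so
  the choice of \<open>pt S\<close> is immaterial.\<close>

lemma ancestor_sum_eq:
  assumes f: "adapted \<mu> \<S> f" and S: "S \<in> \<S>" and x: "x \<in> S"
  shows "(\<Sum>R\<in>{R\<in>\<S>. S \<subset> R}. f R x) = ancestor_sum f S"
  unfolding ancestor_sum_def using S x by (intro sum.cong refl adapted_eq_pt[OF f]) auto

text \<open>A cube that contains a point of \<open>S\<close> is comparable with \<open>S\<close>;
  all remaining functions vanish at that point.\<close>

lemma sum_cubes_eq:
  assumes fin: "finite \<S>" and f: "adapted \<mu> \<S> f" and S: "S \<in> \<S>" and x: "x \<in> S"
  shows "(\<Sum>R\<in>\<S>. f R x) = ancestor_sum f S + (\<Sum>R\<in>{R\<in>\<S>. R \<subseteq> S}. f R x)"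
proof -
  have "(\<Sum>R\<in>\<S>. f R x) = (\<Sum>R\<in>{R\<in>\<S>. S \<subset> R} \<union> {R\<in>\<S>. R \<subseteq> S}. f R x)"
  proof (rule sum.mono_neutral_right[OF fin])
    show "\<forall>R\<in>\<S> - ({R\<in>\<S>. S \<subset> R} \<union> {R\<in>\<S>. R \<subseteq> S}). f R x = 0"
      using nested[OF S _ x] adapted_outside[OF f] by blast
  qed auto
  also have "\<dots> = (\<Sum>R\<in>{R\<in>\<S>. S \<subset> R}. f R x) + (\<Sum>R\<in>{R\<in>\<S>. R \<subseteq> S}. f R x)"
    using fin by (intro sum.union_disjoint) auto
  finally show ?thesis by (simp only: ancestor_sum_eq[OF f S x])
qed

lemma sum_cubes_eq_E_part:
  assumes fin: "finite \<S>" and f: "adapted \<mu> \<S> f" and S: "S \<in> \<S>" and x: "x \<in> E_part \<S> S"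
  shows "(\<Sum>R\<in>\<S>. f R x) = ancestor_sum f S + f S x"
proof -
  have "(\<Sum>R\<in>{R\<in>\<S>. R \<subseteq> S}. f R x) = (\<Sum>R\<in>{S}. f R x)"
  proof (rule sum.mono_neutral_right)
    show "\<forall>R\<in>{R\<in>\<S>. R \<subseteq> S} - {S}. f R x = 0"
      using E_part_not_in_smaller[OF S _ _ x] adapted_outside[OF f] by blast
  qed (use fin S in auto)
  then show ?thesis using sum_cubes_eq[OF fin f S, of x] E_part_subset x by auto
qed

text \<open>No cube of the collection lies strictly between \<open>S\<close> and its child, so
  passing from \<open>S\<close> to \<open>T\<close> adds only the function of \<open>S\<close>
  itself.\<close>

lemma ancestor_sum_ch:
  assumes fin: "finite \<S>" and f: "adapted \<mu> \<S> f" and S: "S \<in> \<S>" and T: "T \<in> ch \<S> S" and x: "x \<in> T"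
  shows "ancestor_sum f T = ancestor_sum f S + f S x"
proof -
  have TS: "T \<in> \<S>" "T \<subset> S" using chD[OF T] by auto
  have "{R\<in>\<S>. T \<subset> R} = insert S {R\<in>\<S>. S \<subset> R}"
  proof (intro equalityI subsetI)
    fix R assume R: "R \<in> {R\<in>\<S>. T \<subset> R}"
    then have "R \<subseteq> S \<or> S \<subseteq> R" using nested_superset[of R S T] S TS by auto
    moreover have "\<not> R \<subset> S" using ch_maximal[OF T, of R] R by blast
    ultimately show "R \<in> insert S {R\<in>\<S>. S \<subset> R}" using R by blast
  qed (use S TS in auto)
  moreover have "ancestor_sum f T = (\<Sum>R\<in>{R\<in>\<S>. T \<subset> R}. f R x)"
    using ancestor_sum_eq[OF f TS(1) x] by simp
  ultimately show ?thesis
    using fin ancestor_sum_eq[OF f S, of x] x TS by (auto simp: add.commute)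
qed

text \<open>On \<open>E_part\<close> and on each child, \<open>f S\<close> is a difference with
  \<open>ancestor_sum f S\<close> subtracted. After the triangle inequality the copies of this
  common term reassemble to the indicator of \<open>S\<close>.\<close>

lemma norm_adapted_le:
  fixes f :: "(real^'n) set \<Rightarrow> real^'n \<Rightarrow> 'e::real_normed_vector"
  assumes fin: "finite \<S>" and f: "adapted \<mu> \<S> f" and S: "S \<in> \<S>"
  shows "norm (f S x) \<le> norm (\<Sum>R\<in>\<S>. f R x) * indicator (E_part \<S> S) x
    + norm (ancestor_sum f S) * indicator S x
    + (\<Sum>T\<in>ch \<S> S. norm (ancestor_sum f T) * indicator T x)"
proof -
  let ?u = "\<lambda>S. norm (ancestor_sum f S)" and ?h = "norm (\<Sum>R\<in>\<S>. f R x)"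
  have "norm (f S x) = norm (f S x) * indicator S x"
    using adapted_outside[OF f S, of x] by (cases "x \<in> S") auto
  also have "\<dots> = norm (f S x) * indicator (E_part \<S> S) x + (\<Sum>T\<in>ch \<S> S. norm (f S x) * indicator T x)"
    by (simp add: indicator_split[OF fin S] distrib_left sum_distrib_left)
  also have "\<dots> \<le> (?h + ?u S) * indicator (E_part \<S> S) x + (\<Sum>T\<in>ch \<S> S. (?u T + ?u S) * indicator T x)"
  proof (intro add_mono sum_mono)
    show "norm (f S x) * indicator (E_part \<S> S) x \<le> (?h + ?u S) * indicator (E_part \<S> S) x"
    proof (cases "x \<in> E_part \<S> S")
      case True
      then show ?thesis
        using norm_triangle_ineq4[of "\<Sum>R\<in>\<S>. f R x" "ancestor_sum f S"]
        by (simp add: sum_cubes_eq_E_part[OF fin f S])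
    qed simp
    fix T assume T: "T \<in> ch \<S> S"
    show "norm (f S x) * indicator T x \<le> (?u T + ?u S) * indicator T x"
    proof (cases "x \<in> T")
      case True
      then show ?thesis
        using norm_triangle_ineq4[of "ancestor_sum f T" "ancestor_sum f S"]
        by (simp add: ancestor_sum_ch[OF fin f S T])
    qed simp
  qed
  also have "\<dots> = ?h * indicator (E_part \<S> S) x + ?u S * indicator S x
      + (\<Sum>T\<in>ch \<S> S. ?u T * indicator T x)"
    by (simp add: indicator_split[OF fin S, of x] distrib_left distrib_right sum.distrib sum_distrib_left)
  finally show ?thesis .
qed

text \<open>On \<open>S\<close> the total sum is the constant \<open>ancestor_sum f S\<close> plus
  the functions of the cubes inside \<open>S\<close>, which together have integral zero. On a cube
  of infinite measure an integrable function can be constant only with value 0, which settles the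
  second claim.\<close>

lemma ancestor_sum_average:
  fixes f :: "(real^'n) set \<Rightarrow> real^'n \<Rightarrow> 'e::real_normed_vector"
  assumes fin: "finite \<S>" and f: "adapted \<mu> \<S> f"
    and mean: "\<And>S. S \<in> \<S> \<Longrightarrow> has_strong_integral \<mu> (f S) 0" and S: "S \<in> \<S>"
  shows "ennreal (norm (ancestor_sum f S)) * emeasure \<mu> S
      \<le> (\<integral>\<^sup>+x. ennreal (norm (\<Sum>R\<in>\<S>. f R x)) * indicator S x \<partial>\<mu>)"
    and "emeasure \<mu> S = top \<Longrightarrow> ancestor_sum f S = 0"
proof -
  show zero: "ancestor_sum f S = 0" if "emeasure \<mu> S = top"
    unfolding ancestor_sum_def
  proof (intro sum.neutral ballI)
    fix R assume R: "R \<in> {R\<in>\<S>. S \<subset> R}"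
    have "ennreal (norm (f R (pt S))) * emeasure \<mu> S = (\<integral>\<^sup>+x. ennreal (norm (f R (pt S))) * indicator S x \<partial>\<mu>)"
      using S by (simp add: nn_integral_cmult_indicator)
    also have "\<dots> \<le> (\<integral>\<^sup>+x. ennreal (norm (f R x)) \<partial>\<mu>)"
    proof (intro nn_integral_mono)
      fix x show "ennreal (norm (f R (pt S))) * indicator S x \<le> ennreal (norm (f R x))"
        using adapted_eq_pt[OF f _ S, of R x] R by (cases "x \<in> S") auto
    qed
    also have "\<dots> < \<infinity>" using R by (intro has_strong_integral_norm_finite[OF mean]) auto
    finally show "f R (pt S) = 0" using that by (simp add: ennreal_mult_top split: if_splits)
  qed
  show "ennreal (norm (ancestor_sum f S)) * emeasure \<mu> S
      \<le> (\<integral>\<^sup>+x. ennreal (norm (\<Sum>R\<in>\<S>. f R x)) * indicator S x \<partial>\<mu>)"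
  proof (cases "emeasure \<mu> S = top")
    case False
    have "has_strong_integral \<mu> (\<lambda>x. \<Sum>R\<in>{R\<in>\<S>. R \<subseteq> S}. f R x) 0"
      by (intro has_strong_integral_sum_zero mean) auto
    then have "ennreal (norm (ancestor_sum f S)) * emeasure \<mu> S
        \<le> (\<integral>\<^sup>+x. ennreal (norm (indicator S x *\<^sub>R ancestor_sum f S + (\<Sum>R\<in>{R\<in>\<S>. R \<subseteq> S}. f R x))) \<partial>\<mu>)"
      using S False by (intro norm_emeasure_le_nn_integral_mean_zero) (auto simp: less_top)
    also have "\<dots> = (\<integral>\<^sup>+x. ennreal (norm (\<Sum>R\<in>\<S>. f R x)) * indicator S x \<partial>\<mu>)"
    proof (intro nn_integral_cong)
      fix x
      show "ennreal (norm (indicator S x *\<^sub>R ancestor_sum f S + (\<Sum>R\<in>{R\<in>\<S>. R \<subseteq> S}. f R x)))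
          = ennreal (norm (\<Sum>R\<in>\<S>. f R x)) * indicator S x"
      proof (cases "x \<in> S")
        case True
        then show ?thesis by (simp add: sum_cubes_eq[OF fin f S])
      next
        case False
        then have "(\<Sum>R\<in>{R\<in>\<S>. R \<subseteq> S}. f R x) = 0"
          using adapted_outside[OF f] by (intro sum.neutral) blast
        then show ?thesis using False by simp
      qed
    qed
    finally show ?thesis .
  qed (simp add: zero)
qed

text \<open>At \<open>p = 1\<close> the constant of the reverse estimate is infinite, so only the
  case of a vanishing sum has content. This bound for a single cube handles it: each of the three
  terms of \<open>norm_adapted_le\<close> integrates to at most the norm of the total sum.\<close>

lemma mean_zero_L1:
  fixes f :: "(real^'n) set \<Rightarrow> real^'n \<Rightarrow> 'e::real_normed_vector"
  assumes fin: "finite \<S>" and f: "adapted \<mu> \<S> f"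
    and mean: "\<And>S. S \<in> \<S> \<Longrightarrow> has_strong_integral \<mu> (f S) 0" and S: "S \<in> \<S>"
  shows "(\<integral>\<^sup>+x. ennreal (norm (f S x)) \<partial>\<mu>) \<le> 3 * (\<integral>\<^sup>+x. ennreal (norm (\<Sum>R\<in>\<S>. f R x)) \<partial>\<mu>)"
proof -
  let ?h = "\<lambda>x. norm (\<Sum>R\<in>\<S>. f R x)"
  let ?u = "\<lambda>S. norm (ancestor_sum f S)"
  let ?I = "\<integral>\<^sup>+x. ennreal (?h x) \<partial>\<mu>"
  have h [measurable]: "?h \<in> borel_measurable \<mu>"
    by (intro borel_measurable_norm_strongly_measurable strongly_measurable_sum adapted_measurable[OF f])
  have T: "T \<in> \<S>" if "T \<in> ch \<S> S" for T using chD[OF that] by simp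
  have [measurable]: "T \<in> sets \<mu>" if "T \<in> ch \<S> S" for T using T[OF that] by simp
  have [measurable]: "S \<in> sets \<mu>" "E_part \<S> S \<in> sets \<mu>" using S by auto
  have "(\<integral>\<^sup>+x. ennreal (norm (f S x)) \<partial>\<mu>)
      \<le> (\<integral>\<^sup>+x. ennreal (?h x) + ennreal (?u S) * indicator S x
          + (\<Sum>T\<in>ch \<S> S. ennreal (?u T) * indicator T x) \<partial>\<mu>)"
  proof (intro nn_integral_mono)
    fix x
    have "norm (f S x) \<le> ?h x + ?u S * indicator S x + (\<Sum>T\<in>ch \<S> S. ?u T * indicator T x)"
      by (rule order_trans[OF norm_adapted_le[OF fin f S]]) (auto simp: indicator_def)
    then have "ennreal (norm (f S x))
        \<le> ennreal (?h x + ?u S * indicator S x + (\<Sum>T\<in>ch \<S> S. ?u T * indicator T x))"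
      by (rule ennreal_leI)
    also have "\<dots> = ennreal (?h x) + ennreal (?u S * indicator S x)
        + ennreal (\<Sum>T\<in>ch \<S> S. ?u T * indicator T x)"
      by (simp add: sum_nonneg)
    also have "\<dots> = ennreal (?h x) + ennreal (?u S) * indicator S x
          + (\<Sum>T\<in>ch \<S> S. ennreal (?u T) * indicator T x)"
      by (subst sum_ennreal_indicator) (auto simp: indicator_def)
    finally show "ennreal (norm (f S x)) \<le> ennreal (?h x) + ennreal (?u S) * indicator S x
          + (\<Sum>T\<in>ch \<S> S. ennreal (?u T) * indicator T x)" .
  qed
  also have "\<dots> = ?I + ennreal (?u S) * emeasure \<mu> S + (\<Sum>T\<in>ch \<S> S. ennreal (?u T) * emeasure \<mu> T)"
    by (simp add: nn_integral_add nn_integral_sum nn_integral_cmult_indicator)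
  also have "\<dots> \<le> ?I + ?I + ?I"
  proof (intro add_mono order_refl)
    show "ennreal (?u S) * emeasure \<mu> S \<le> ?I"
      by (rule order_trans[OF ancestor_sum_average(1)[OF fin f mean S]])
        (auto intro!: nn_integral_mono simp: indicator_def)
    have "(\<Sum>T\<in>ch \<S> S. ennreal (?u T) * emeasure \<mu> T)
        \<le> (\<Sum>T\<in>ch \<S> S. \<integral>\<^sup>+x. ennreal (?h x) * indicator T x \<partial>\<mu>)"
      using T by (intro sum_mono ancestor_sum_average(1)[OF fin f mean])
    also have "\<dots> = (\<integral>\<^sup>+x. (\<Sum>T\<in>ch \<S> S. ennreal (?h x) * indicator T x) \<partial>\<mu>)"
      by (rule nn_integral_sum[symmetric]) measurable
    also have "\<dots> \<le> ?I"
    proof (intro nn_integral_mono)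
      fix x
      have "(\<Sum>T\<in>ch \<S> S. ?h x * indicator T x) = ?h x * (\<Sum>T\<in>ch \<S> S. indicator T x)"
        by (simp add: sum_distrib_left)
      also have "\<dots> \<le> ?h x * 1"
        by (intro mult_left_mono sum_ch_indicator_le_1 fin S) simp
      finally show "(\<Sum>T\<in>ch \<S> S. ennreal (?h x) * indicator T x) \<le> ennreal (?h x)"
        by (subst sum_ennreal_indicator) (auto intro: ennreal_leI)
    qed
    finally show "(\<Sum>T\<in>ch \<S> S. ennreal (?u T) * emeasure \<mu> T) \<le> ?I" .
  qed
  also have "\<dots> = 3 * ?I"
  proof -
    have "(3::ennreal) = 1 + 1 + 1" by simp
    then show ?thesis by (simp only: distrib_right mult_1)
  qed
  finally show ?thesis .
qed

text \<open>After taking \<open>p\<close>-th powers in \<open>norm_adapted_le\<close> and summing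
  over the cubes, disjointness of the sets \<open>E_part\<close> leaves one copy of the total sum.
  Every ancestor term occurs at most twice, for the cube itself and as a child of its parent, and is
  controlled by the Carleson embedding.\<close>

lemma mean_zero_Lp:
  fixes f :: "(real^'n) set \<Rightarrow> real^'n \<Rightarrow> 'e::real_normed_vector"
  assumes fin: "finite \<S>" and p: "1 < p" and f: "adapted \<mu> \<S> f"
    and mean: "\<And>S. S \<in> \<S> \<Longrightarrow> has_strong_integral \<mu> (f S) 0"
  shows "(\<Sum>S\<in>\<S>. \<integral>\<^sup>+x. ennreal (norm (f S x) powr p) \<partial>\<mu>)
    \<le> ennreal ((6 * (p / (p - 1))) powr p) * (\<integral>\<^sup>+x. ennreal (norm (\<Sum>R\<in>\<S>. f R x) powr p) \<partial>\<mu>)"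
proof -
  let ?h = "\<lambda>x. norm (\<Sum>R\<in>\<S>. f R x)"
  let ?u = "\<lambda>S. norm (ancestor_sum f S)"
  let ?I = "\<integral>\<^sup>+x. ennreal (?h x powr p) \<partial>\<mu>"
  let ?Z = "\<Sum>S\<in>\<S>. ennreal (?u S powr p) * emeasure \<mu> S"
  define q where "q = p / (p - 1)"
  have q: "1 \<le> q" using p by (simp add: q_def)
  have h [measurable]: "?h \<in> borel_measurable \<mu>"
    by (intro borel_measurable_norm_strongly_measurable strongly_measurable_sum adapted_measurable[OF f])
  have pointwise: "norm (f S x) powr p \<le> 3 powr (p - 1) * (?h x powr p * indicator (E_part \<S> S) x
      + ?u S powr p * indicator S x + (\<Sum>T\<in>ch \<S> S. ?u T powr p * indicator T x))"
    if S: "S \<in> \<S>" for S x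
  proof -
    have "finite (ch \<S> S)" using fin by (auto simp: ch_def)
    then have "(\<Sum>T\<in>ch \<S> S. ?u T * indicator T x) powr p = (\<Sum>T\<in>ch \<S> S. (?u T * indicator T x) powr p)"
      by (rule sum_powr_eq_powr_sum) (auto simp: indicator_def dest: ch_disjoint split: if_splits)
    moreover have "norm (f S x) powr p \<le> (?h x * indicator (E_part \<S> S) x
        + ?u S * indicator S x + (\<Sum>T\<in>ch \<S> S. ?u T * indicator T x)) powr p"
      using p by (intro powr_mono2 norm_adapted_le fin f S) auto
    moreover have "\<dots> \<le> 3 powr (p - 1) * ((?h x * indicator (E_part \<S> S) x) powr p
        + (?u S * indicator S x) powr p + (\<Sum>T\<in>ch \<S> S. ?u T * indicator T x) powr p)"
      using p by (intro powr_add3_le) (auto intro!: sum_nonneg)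
    ultimately show ?thesis using p by (simp add: powr_mult_indicator)
  qed
  have split: "(\<Sum>S\<in>\<S>. norm (f S x) powr p)
      \<le> 3 powr (p - 1) * (?h x powr p + (\<Sum>S\<in>\<S>. 2 * ?u S powr p * indicator S x))" for x
  proof -
    have "(\<Sum>S\<in>\<S>. norm (f S x) powr p) \<le> (\<Sum>S\<in>\<S>. 3 powr (p - 1) * (?h x powr p * indicator (E_part \<S> S) x
      + ?u S powr p * indicator S x + (\<Sum>T\<in>ch \<S> S. ?u T powr p * indicator T x)))"
      by (intro sum_mono pointwise)
    also have "\<dots> = 3 powr (p - 1) * (?h x powr p * (\<Sum>S\<in>\<S>. indicator (E_part \<S> S) x)
        + (\<Sum>S\<in>\<S>. ?u S powr p * indicator S x)
        + (\<Sum>S\<in>\<S>. \<Sum>T\<in>ch \<S> S. ?u T powr p * indicator T x))"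
      by (simp add: sum_distrib_left sum.distrib distrib_left)
    also have "\<dots> \<le> 3 powr (p - 1) * (?h x powr p * 1 + (\<Sum>S\<in>\<S>. ?u S powr p * indicator S x)
        + (\<Sum>S\<in>\<S>. ?u S powr p * indicator S x))"
    proof (intro mult_left_mono add_mono order_refl)
      show "(\<Sum>S\<in>\<S>. indicator (E_part \<S> S) x :: real) \<le> 1"
      proof (cases "\<exists>S\<in>\<S>. x \<in> E_part \<S> S")
        case True
        then obtain S where S: "S \<in> \<S>" "x \<in> E_part \<S> S" by auto
        have "(\<Sum>R\<in>\<S> - {S}. indicator (E_part \<S> R) x :: real) = 0"
          using E_part_disjoint[OF S(1) _ S(2)] by (intro sum.neutral) (auto simp: indicator_def)
        then show ?thesis using S by (simp add: sum.remove[OF fin S(1)])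
      qed (simp add: indicator_def)
      have "(\<Sum>S\<in>\<S>. \<Sum>T\<in>ch \<S> S. ?u T powr p * indicator T x)
          = (\<Sum>T\<in>\<S>. real (card {S\<in>\<S>. T \<in> ch \<S> S}) * (?u T powr p * indicator T x))"
        by (simp add: sum_ch_swap[OF fin])
      also have "\<dots> \<le> (\<Sum>T\<in>\<S>. 1 * (?u T powr p * indicator T x))"
      proof (intro sum_mono mult_right_mono)
        fix T assume "T \<in> \<S>"
        have "card {S\<in>\<S>. T \<in> ch \<S> S} \<le> 1"
          using parent_unique fin by (intro card_le_Suc0_iff_eq[THEN iffD2, unfolded One_nat_def[symmetric]]) auto
        then show "real (card {S\<in>\<S>. T \<in> ch \<S> S}) \<le> 1" by simp
      qed auto
      finally show "(\<Sum>S\<in>\<S>. \<Sum>T\<in>ch \<S> S. ?u T powr p * indicator T x)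
          \<le> (\<Sum>S\<in>\<S>. ?u S powr p * indicator S x)" by simp
    qed auto
    also have "\<dots> = 3 powr (p - 1) * (?h x powr p + (\<Sum>S\<in>\<S>. 2 * ?u S powr p * indicator S x))"
      by (simp add: mult.assoc flip: sum_distrib_left)
    finally show ?thesis .
  qed
  have "(\<Sum>S\<in>\<S>. \<integral>\<^sup>+x. ennreal (norm (f S x) powr p) \<partial>\<mu>)
      = (\<integral>\<^sup>+x. (\<Sum>S\<in>\<S>. ennreal (norm (f S x) powr p)) \<partial>\<mu>)"
    using measurable_norm_powr[OF adapted_measurable[OF f]]
    by (intro nn_integral_sum[symmetric]) simp
  also have "\<dots> \<le> (\<integral>\<^sup>+x. ennreal (3 powr (p - 1)) * (ennreal (?h x powr p)
      + (\<Sum>S\<in>\<S>. ennreal (2 * ?u S powr p) * indicator S x)) \<partial>\<mu>)"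
  proof (intro nn_integral_mono)
    fix x
    have "(\<Sum>S\<in>\<S>. ennreal (norm (f S x) powr p)) = ennreal (\<Sum>S\<in>\<S>. norm (f S x) powr p)"
      by (rule sum_ennreal) simp
    also have "\<dots> \<le> ennreal (3 powr (p - 1) * (?h x powr p + (\<Sum>S\<in>\<S>. 2 * ?u S powr p * indicator S x)))"
      by (intro ennreal_leI split)
    also have "\<dots> = ennreal (3 powr (p - 1)) * (ennreal (?h x powr p)
      + ennreal (\<Sum>S\<in>\<S>. 2 * ?u S powr p * indicator S x))"
      by (simp add: ennreal_mult' sum_nonneg)
    also have "ennreal (\<Sum>S\<in>\<S>. 2 * ?u S powr p * indicator S x)
        = (\<Sum>S\<in>\<S>. ennreal (2 * ?u S powr p) * indicator S x)"
      by (rule sum_ennreal_indicator[symmetric]) simp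
    finally show "(\<Sum>S\<in>\<S>. ennreal (norm (f S x) powr p)) \<le> ennreal (3 powr (p - 1)) * (ennreal (?h x powr p)
      + (\<Sum>S\<in>\<S>. ennreal (2 * ?u S powr p) * indicator S x))" .
  qed
  also have "\<dots> = ennreal (3 powr (p - 1)) * (?I + 2 * ?Z)"
  proof -
    have "(\<integral>\<^sup>+x. (\<Sum>S\<in>\<S>. ennreal (2 * ?u S powr p) * indicator S x) \<partial>\<mu>)
        = (\<Sum>S\<in>\<S>. ennreal (2 * ?u S powr p) * emeasure \<mu> S)"
      by (subst nn_integral_sum) (auto simp: nn_integral_cmult_indicator intro!: sum.cong)
    also have "\<dots> = 2 * ?Z"
      by (simp add: sum_distrib_left ennreal_mult mult.assoc)
    finally show ?thesis by (simp add: nn_integral_cmult nn_integral_add)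
  qed
  also have "\<dots> \<le> ennreal (3 powr (p - 1)) * (?I + 2 * (ennreal (2 * q powr p) * ?I))"
    unfolding q_def
    by (intro mult_left_mono add_left_mono Carleson_embedding fin p h ancestor_sum_average(1)[OF fin f mean])
      (auto simp: ancestor_sum_average(2)[OF fin f mean])
  also have "\<dots> = ennreal (3 powr (p - 1) * (1 + 2 * (2 * q powr p))) * ?I"
    by (simp add: ennreal_mult ennreal_plus distrib_right mult.assoc del: times_divide_eq_left)
  also have "\<dots> \<le> ennreal ((6 * q) powr p) * ?I"
  proof (intro mult_right_mono ennreal_leI)
    \<comment> \<open>The constant comes from \<open>1 + 4 * q powr p \<le> 6 * q powr p\<close> and
      \<open>3 powr (p - 1) * 6 = 2 * 3 powr p\<close>, with
      \<open>2 \<le> 2 powr p\<close>.\<close>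
    have "1 \<le> q powr p" using q p by (simp add: ge_one_powr_ge_zero)
    then have "3 powr (p - 1) * (1 + 2 * (2 * q powr p)) \<le> 3 powr (p - 1) * (6 * q powr p)"
      by (intro mult_left_mono) auto
    also have "\<dots> = 2 * 3 powr p * q powr p" by (simp add: powr_diff)
    also have "\<dots> \<le> 2 powr p * 3 powr p * q powr p"
      using powr_mono[of 1 p "2::real"] p by (intro mult_right_mono) auto
    also have "\<dots> = (6 * q) powr p" using q by (simp add: powr_mult flip: powr_mult[of 2 3])
    finally show "3 powr (p - 1) * (1 + 2 * (2 * q powr p)) \<le> (6 * q) powr p" .
  qed simp
  finally show ?thesis by (simp add: q_def)
qed

end

section \<open>Passage to infinite collections\<close>

lemma epowr_less_top_iff: "epowr x a < top \<longleftrightarrow> x < top"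
  by (cases x) (simp_all add: epowr_ennreal)

lemma eventually_finite_supersets:
  assumes "finite F0" and "F0 \<subseteq> I" and "\<And>F. finite F \<Longrightarrow> F0 \<subseteq> F \<Longrightarrow> F \<subseteq> I \<Longrightarrow> P F"
  shows "eventually P (finite_subsets_at_top I)"
  unfolding eventually_finite_subsets_at_top using assms by blast

lemma Lp_has_sum_norm_le:
  fixes f :: "'i \<Rightarrow> 'a \<Rightarrow> 'b::real_normed_vector"
  assumes p: "1 \<le> p" and g: "Lp_has_sum M p I f g"
    and f: "\<And>i. i \<in> I \<Longrightarrow> strongly_measurable M (f i)"
    and K: "\<And>F. finite F \<Longrightarrow> F \<subseteq> I \<Longrightarrow> Lp_norm M p (\<lambda>x. \<Sum>i\<in>F. f i x) \<le> K"
  shows "Lp_norm M p g \<le> K"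
proof -
  have gm: "strongly_measurable M g" using g by (simp add: Lp_has_sum_def)
  let ?D = "\<lambda>F. Lp_norm M p (\<lambda>x. (\<Sum>i\<in>F. f i x) - g x)"
  have lim: "((\<lambda>F. ?D F + K) \<longlongrightarrow> 0 + K) (finite_subsets_at_top I)"
    using g unfolding Lp_has_sum_def by (intro tendsto_add tendsto_const) simp
  have "\<forall>\<^sub>F F in finite_subsets_at_top I. Lp_norm M p g \<le> ?D F + K"
  proof (rule eventually_finite_supersets[of "{}"])
    fix F assume F: "finite F" "F \<subseteq> I"
    have Fm: "strongly_measurable M (\<lambda>x. \<Sum>i\<in>F. f i x)"
      using F f by (intro strongly_measurable_sum) auto
    have "Lp_norm M p (\<lambda>x. (g x - (\<Sum>i\<in>F. f i x)) + (\<Sum>i\<in>F. f i x))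
        \<le> Lp_norm M p (\<lambda>x. g x - (\<Sum>i\<in>F. f i x)) + Lp_norm M p (\<lambda>x. \<Sum>i\<in>F. f i x)"
      by (intro Lp_norm_triangle p strongly_measurable_diff gm Fm)
    also have "\<dots> \<le> ?D F + K"
      using K[OF F] by (subst Lp_norm_minus_commute) (rule add_left_mono)
    finally show "Lp_norm M p g \<le> ?D F + K" by simp
  qed auto
  from tendsto_lowerbound[OF lim this] show ?thesis by simp
qed

text \<open>The triangle inequality costs only the error of the partial sum, which tends to 0. The
  hypothesis concerns only finite sets above \<open>F0\<close>, which is eventually the case along
  the filter.\<close>

lemma Lp_has_sum_norm_ge:
  fixes f :: "'i \<Rightarrow> 'a \<Rightarrow> 'b::real_normed_vector"
  assumes p: "1 \<le> p" and g: "Lp_has_sum M p I f g"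
    and f: "\<And>i. i \<in> I \<Longrightarrow> strongly_measurable M (f i)"
    and F0: "finite F0" "F0 \<subseteq> I"
    and c: "\<And>F. finite F \<Longrightarrow> F0 \<subseteq> F \<Longrightarrow> F \<subseteq> I \<Longrightarrow> c \<le> ennreal C * Lp_norm M p (\<lambda>x. \<Sum>i\<in>F. f i x)"
  shows "c \<le> ennreal C * Lp_norm M p g"
proof -
  have gm: "strongly_measurable M g" using g by (simp add: Lp_has_sum_def)
  let ?D = "\<lambda>F. Lp_norm M p (\<lambda>x. (\<Sum>i\<in>F. f i x) - g x)"
  have lim: "((\<lambda>F. ennreal C * ?D F + ennreal C * Lp_norm M p g) \<longlongrightarrow> ennreal C * 0 + ennreal C * Lp_norm M p g)
      (finite_subsets_at_top I)"
    using g unfolding Lp_has_sum_def by (intro tendsto_add tendsto_const ennreal_tendsto_cmult) auto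
  have "\<forall>\<^sub>F F in finite_subsets_at_top I. c \<le> ennreal C * ?D F + ennreal C * Lp_norm M p g"
  proof (rule eventually_finite_supersets[OF F0])
    fix F assume F: "finite F" "F0 \<subseteq> F" "F \<subseteq> I"
    have Fm: "strongly_measurable M (\<lambda>x. \<Sum>i\<in>F. f i x)"
      using F f by (intro strongly_measurable_sum) auto
    have "Lp_norm M p (\<lambda>x. ((\<Sum>i\<in>F. f i x) - g x) + g x) \<le> ?D F + Lp_norm M p g"
      by (intro Lp_norm_triangle p strongly_measurable_diff gm Fm)
    then have "ennreal C * Lp_norm M p (\<lambda>x. \<Sum>i\<in>F. f i x) \<le> ennreal C * (?D F + Lp_norm M p g)"
      by (intro mult_left_mono) simp_all
    then show "c \<le> ennreal C * ?D F + ennreal C * Lp_norm M p g"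
      using c[OF F] by (simp add: distrib_left)
  qed
  from tendsto_lowerbound[OF lim this] show ?thesis by simp
qed

lemma conj_exponent_one: "conj_exponent 1 = top"
  by (simp add: conj_exponent_def)

lemma conj_exponent_eq: "1 < p \<Longrightarrow> conj_exponent p = ennreal (p / (p - 1))"
proof -
  assume p: "1 < p"
  then have "conj_exponent p = inverse (ennreal (1 - 1 / p))"
    by (simp add: conj_exponent_def inverse_ennreal inverse_eq_divide ennreal_minus flip: ennreal_1)
  also have "\<dots> = ennreal (p / (p - 1))"
    using p by (simp add: inverse_ennreal field_simps)
  finally show ?thesis .
qed

lemma lp_Lp_norm_eq_0I:
  assumes "0 < p" and "\<And>i. i \<in> I \<Longrightarrow> Lp_norm M p (f i) = 0"
  shows "lp_Lp_norm M p I f = 0"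
  using assms by (simp add: lp_Lp_norm_def cong: infsum_cong)

text \<open>A finite \<open>F0\<close> whose sum comes within \<open>e\<close> of the total leaves
  at most \<open>e\<close> for any finite set disjoint from it. Finiteness of the total is what
  makes cancellation in \<open>ennreal\<close> valid.\<close>

lemma ennreal_sum_tail:
  fixes b :: "'i \<Rightarrow> ennreal"
  assumes fin: "(\<Sum>\<^sub>\<infinity>i\<in>I. b i) < top" and e: "0 < e"
  obtains F0 where "finite F0" and "F0 \<subseteq> I"
    and "\<And>F. finite F \<Longrightarrow> F \<subseteq> I - F0 \<Longrightarrow> sum b F \<le> ennreal e"
proof -
  let ?t = "\<Sum>\<^sub>\<infinity>i\<in>I. b i"
  have t: "?t = (SUP F\<in>{F. finite F \<and> F \<subseteq> I}. sum b F)" by (rule nonneg_infsum_complete) simp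
  have le: "sum b F \<le> ?t" if "finite F" "F \<subseteq> I" for F
    unfolding t using that by (intro SUP_upper) auto
  obtain F0 where F0: "finite F0" "F0 \<subseteq> I" "?t \<le> sum b F0 + ennreal e"
  proof (cases "?t = 0")
    case True
    then show ?thesis using that[of "{}"] by simp
  next
    case False
    then have "?t - ennreal e < ?t" using fin e by (intro ennreal_between) (auto simp: zero_less_iff_neq_zero)
    then obtain F0 where "finite F0" "F0 \<subseteq> I" "?t - ennreal e < sum b F0"
      unfolding t less_SUP_iff by auto
    then show ?thesis
      using that[of F0] fin by (auto simp: ennreal_minus_le_iff add.commute dest!: less_imp_le)
  qed
  have "sum b F \<le> ennreal e" if F: "finite F" "F \<subseteq> I - F0" for F
  proof -
    have "sum b F0 + sum b F = sum b (F0 \<union> F)"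
      using F F0(1) by (intro sum.union_disjoint[symmetric]) auto
    also have "\<dots> \<le> sum b F0 + ennreal e"
      using F F0 by (intro order_trans[OF le F0(3)]) auto
    finally show ?thesis
      using le[OF F0(1,2)] fin by (subst (asm) ennreal_add_left_cancel_le) (auto simp: top_unique)
  qed
  then show ?thesis using that F0 by blast
qed

context sparse_dyadic
begin

lemma Lp_norm_finite_sum_le:
  fixes f :: "(real^'n) set \<Rightarrow> real^'n \<Rightarrow> 'e::real_normed_vector"
  assumes p: "1 \<le> p" and f: "adapted \<mu> \<S> f" and F: "finite F" "F \<subseteq> \<S>"
  shows "Lp_norm \<mu> p (\<lambda>x. \<Sum>S\<in>F. f S x) \<le> 3 * ennreal p * lp_Lp_norm \<mu> p \<S> f"
proof -
  interpret F: sparse_dyadic \<mu> F by (rule subcollection[OF F(2)])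
  have "(\<integral>\<^sup>+x. ennreal (norm (\<Sum>S\<in>F. f S x) powr p) \<partial>\<mu>)
      \<le> (\<integral>\<^sup>+x. ennreal ((\<Sum>S\<in>F. norm (f S x)) powr p) \<partial>\<mu>)"
    using p by (intro nn_integral_mono ennreal_leI powr_mono2 norm_sum) auto
  also have "\<dots> \<le> ennreal ((3 * p) powr p) * (\<Sum>S\<in>F. \<integral>\<^sup>+x. ennreal (norm (f S x) powr p) \<partial>\<mu>)"
    by (rule F.nn_integral_sum_norm_powr_le[OF F(1) p adapted_subcollection[OF F(2) f]])
  also have "\<dots> \<le> ennreal ((3 * p) powr p) * epowr (lp_Lp_norm \<mu> p \<S> f) p"
    using p F lp_Lp_norm_le_iff[of p \<mu> \<S> f "lp_Lp_norm \<mu> p \<S> f"] by (intro mult_left_mono) auto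
  also have "ennreal ((3 * p) powr p) = epowr (3 * ennreal p) p"
  proof -
    have "3 * ennreal p = ennreal (3 * p)" using p by (simp add: ennreal_mult)
    then show ?thesis using p by (simp add: epowr_ennreal)
  qed
  finally show ?thesis
    using p by (subst Lp_norm_le_iff) (simp_all add: epowr_mult)
qed

lemma forward_estimate:
  fixes f :: "(real^'n) set \<Rightarrow> real^'n \<Rightarrow> 'e::real_normed_vector"
  assumes p: "1 \<le> p" and f: "adapted \<mu> \<S> f" and g: "Lp_has_sum \<mu> p \<S> f g"
  shows "Lp_norm \<mu> p g \<le> 3 * ennreal p * lp_Lp_norm \<mu> p \<S> f"
  using Lp_norm_finite_sum_le[OF p f] adapted_measurable[OF f] by (intro Lp_has_sum_norm_le[OF p g]) auto

text \<open>For fixed \<open>F0\<close> the sum of norm powers only grows on passing to a finite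
  \<open>F\<close> above \<open>F0\<close>, where the estimate is available; then \<open>F\<close>
  exhausts the collection.\<close>

lemma reverse_estimate_if_finite:
  fixes f :: "(real^'n) set \<Rightarrow> real^'n \<Rightarrow> 'e::real_normed_vector"
  assumes p: "1 \<le> p" and f: "adapted \<mu> \<S> f" and g: "Lp_has_sum \<mu> p \<S> f g" and C: "0 \<le> C"
    and est: "\<And>F. finite F \<Longrightarrow> F \<subseteq> \<S> \<Longrightarrow> (\<Sum>S\<in>F. \<integral>\<^sup>+x. ennreal (norm (f S x) powr p) \<partial>\<mu>)
      \<le> ennreal (C powr p) * (\<integral>\<^sup>+x. ennreal (norm (\<Sum>S\<in>F. f S x) powr p) \<partial>\<mu>)"
  shows "lp_Lp_norm \<mu> p \<S> f \<le> ennreal C * Lp_norm \<mu> p g"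
proof -
  have p0: "0 < p" using p by simp
  let ?N = "\<lambda>F. \<Sum>S\<in>F. \<integral>\<^sup>+x. ennreal (norm (f S x) powr p) \<partial>\<mu>"
  have "?N F0 \<le> epowr (ennreal C * Lp_norm \<mu> p g) p" if F0: "finite F0" "F0 \<subseteq> \<S>" for F0
  proof -
    have "epowr (?N F0) (1 / p) \<le> ennreal C * Lp_norm \<mu> p g"
    proof (rule Lp_has_sum_norm_ge[OF p g _ F0])
      fix F assume F: "finite F" "F0 \<subseteq> F" "F \<subseteq> \<S>"
      have "?N F0 \<le> ?N F" using F by (intro sum_mono2) auto
      also have "\<dots> \<le> ennreal (C powr p) * (\<integral>\<^sup>+x. ennreal (norm (\<Sum>S\<in>F. f S x) powr p) \<partial>\<mu>)"
        by (rule est[OF F(1,3)])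
      also have "\<dots> = epowr (ennreal C * Lp_norm \<mu> p (\<lambda>x. \<Sum>S\<in>F. f S x)) p"
        using C p0 by (simp add: epowr_mult epowr_Lp_norm epowr_ennreal)
      finally show "epowr (?N F0) (1 / p) \<le> ennreal C * Lp_norm \<mu> p (\<lambda>x. \<Sum>S\<in>F. f S x)"
        using p0 by (simp add: epowr_le_iff)
    qed (rule adapted_measurable[OF f])
    then show ?thesis using p0 by (simp add: epowr_le_iff)
  qed
  then show ?thesis using p0 by (subst lp_Lp_norm_le_iff) auto
qed

lemma reverse_estimate_mean_zero:
  fixes f :: "(real^'n) set \<Rightarrow> real^'n \<Rightarrow> 'e::real_normed_vector"
  assumes p: "1 \<le> p" and f: "adapted \<mu> \<S> f" and g: "Lp_has_sum \<mu> p \<S> f g"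
    and mean: "\<And>S. S \<in> \<S> \<Longrightarrow> has_strong_integral \<mu> (f S) 0"
  shows "lp_Lp_norm \<mu> p \<S> f \<le> 6 * conj_exponent p * Lp_norm \<mu> p g"
proof (cases "p = 1")
  case False
  then have p1: "1 < p" using p by simp
  have "lp_Lp_norm \<mu> p \<S> f \<le> ennreal (6 * (p / (p - 1))) * Lp_norm \<mu> p g"
  proof (rule reverse_estimate_if_finite[OF p f g])
    fix F assume F: "finite F" "F \<subseteq> \<S>"
    interpret F: sparse_dyadic \<mu> F by (rule subcollection[OF F(2)])
    show "(\<Sum>S\<in>F. \<integral>\<^sup>+x. ennreal (norm (f S x) powr p) \<partial>\<mu>)
      \<le> ennreal ((6 * (p / (p - 1))) powr p) * (\<integral>\<^sup>+x. ennreal (norm (\<Sum>S\<in>F. f S x) powr p) \<partial>\<mu>)"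
      using F by (intro F.mean_zero_Lp p1 adapted_subcollection[OF _ f] mean) auto
  qed (use p1 in simp)
  also have "ennreal (6 * (p / (p - 1))) = 6 * conj_exponent p"
    unfolding conj_exponent_eq[OF p1] using p1 by (subst ennreal_mult) auto
  finally show ?thesis .
next
  \<comment> \<open>Here \<open>conj_exponent p\<close> is \<open>top\<close>, and the right-hand
    side is infinite unless the norm of \<open>g\<close> is 0. In that case
    \<open>top * 0 = 0\<close> in \<open>ennreal\<close>, so every \<open>f S\<close> has to be
    shown to have norm 0.\<close>
  case True
  show ?thesis
  proof (cases "Lp_norm \<mu> p g = 0")
    case zero: True
    have "Lp_norm \<mu> p (f S) = 0" if S: "S \<in> \<S>" for S
    proof -
      have "Lp_norm \<mu> p (f S) \<le> ennreal 3 * Lp_norm \<mu> p g"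
      proof (rule Lp_has_sum_norm_ge[OF p g, of "{S}"])
        fix F assume F: "finite F" "{S} \<subseteq> F" "F \<subseteq> \<S>"
        interpret F: sparse_dyadic \<mu> F by (rule subcollection[OF F(3)])
        show "Lp_norm \<mu> p (f S) \<le> ennreal 3 * Lp_norm \<mu> p (\<lambda>x. \<Sum>R\<in>F. f R x)"
          using F F.mean_zero_L1[OF F(1) adapted_subcollection[OF F(3) f], of S] mean
          by (auto simp: Lp_norm_def True)
      qed (use S adapted_measurable[OF f] in auto)
      then show ?thesis by (simp add: zero)
    qed
    then show ?thesis using p by (subst lp_Lp_norm_eq_0I) auto
  next
    case False
    then show ?thesis by (simp add: True conj_exponent_one ennreal_mult_top ennreal_top_mult)
  qed
qed

text \<open>For nonnegative functions superadditivity of the power holds pointwise and gives the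
  constant 1, which is at most \<open>6 * conj_exponent p\<close>.\<close>

lemma reverse_estimate_nonneg:
  fixes f :: "(real^'n) set \<Rightarrow> real^'n \<Rightarrow> real"
  assumes p: "1 \<le> p" and f: "adapted \<mu> \<S> f" and g: "Lp_has_sum \<mu> p \<S> f g"
    and nonneg: "\<And>S x. S \<in> \<S> \<Longrightarrow> 0 \<le> f S x"
  shows "lp_Lp_norm \<mu> p \<S> f \<le> 6 * conj_exponent p * Lp_norm \<mu> p g"
proof -
  have "lp_Lp_norm \<mu> p \<S> f \<le> ennreal 1 * Lp_norm \<mu> p g"
  proof (rule reverse_estimate_if_finite[OF p f g])
    fix F assume F: "finite F" "F \<subseteq> \<S>"
    have "(\<Sum>S\<in>F. \<integral>\<^sup>+x. ennreal (norm (f S x) powr p) \<partial>\<mu>)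
        = (\<integral>\<^sup>+x. (\<Sum>S\<in>F. ennreal (norm (f S x) powr p)) \<partial>\<mu>)"
      using measurable_norm_powr[OF adapted_measurable[OF f]] F
      by (intro nn_integral_sum[symmetric]) auto
    also have "\<dots> \<le> (\<integral>\<^sup>+x. ennreal (norm (\<Sum>S\<in>F. f S x) powr p) \<partial>\<mu>)"
    proof (intro nn_integral_mono)
      fix x
      have nn: "0 \<le> f S x" if "S \<in> F" for S using nonneg that F by auto
      have "(\<Sum>S\<in>F. norm (f S x) powr p) \<le> norm (\<Sum>S\<in>F. f S x) powr p"
        using sum_powr_le_powr_sum[OF p nn] nn by (simp add: sum_nonneg)
      then show "(\<Sum>S\<in>F. ennreal (norm (f S x) powr p)) \<le> ennreal (norm (\<Sum>S\<in>F. f S x) powr p)"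
        by (subst sum_ennreal) (auto intro: ennreal_leI)
    qed
    finally show "(\<Sum>S\<in>F. \<integral>\<^sup>+x. ennreal (norm (f S x) powr p) \<partial>\<mu>)
        \<le> ennreal (1 powr p) * (\<integral>\<^sup>+x. ennreal (norm (\<Sum>S\<in>F. f S x) powr p) \<partial>\<mu>)" by simp
  qed simp
  also have "\<dots> \<le> 6 * conj_exponent p * Lp_norm \<mu> p g"
  proof (intro mult_right_mono)
    have "1 \<le> conj_exponent p"
      using p by (cases "p = 1") (auto simp: conj_exponent_one conj_exponent_eq simp flip: ennreal_1 intro!: ennreal_leI)
    then have "1 * 1 \<le> 6 * conj_exponent p" by (intro mult_mono) auto
    then show "ennreal 1 \<le> 6 * conj_exponent p" by simp
  qed simp
  finally show ?thesis .
qed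

end

section \<open>Convergence of the series almost everywhere and in the \<open>p\<close>-norm\<close>

lemma powr_le_imp_le:
  fixes x :: real
  assumes "0 < p" and "0 \<le> x" and "x powr p \<le> M"
  shows "x \<le> M powr (1 / p)"
proof -
  have "x = (x powr p) powr (1 / p)" using assms by (simp add: powr_powr)
  also have "\<dots> \<le> M powr (1 / p)" using assms by (intro powr_mono2) auto
  finally show ?thesis .
qed

context sparse_dyadic
begin

text \<open>An enumeration of the countable collection gives an increasing sequence of finite
  subcollections. It replaces the limit along finite subsets by a sequential one, as measurability
  and monotone convergence require.\<close>

definition exhaust :: "nat \<Rightarrow> (real^'n) set set" where
  "exhaust n = {S\<in>\<S>. to_nat_on \<S> S < n}"

lemma finite_exhaust: "finite (exhaust n)"
proof (rule finite_imageD)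
  show "finite (to_nat_on \<S> ` exhaust n)"
    by (rule finite_subset[of _ "{..<n}"]) (auto simp: exhaust_def)
  show "inj_on (to_nat_on \<S>) (exhaust n)"
    using inj_on_to_nat_on[OF countable_cubes] by (rule inj_on_subset) (auto simp: exhaust_def)
qed

lemma exhaust_subset: "exhaust n \<subseteq> \<S>"
  by (auto simp: exhaust_def)

lemma exhaust_mono: "m \<le> n \<Longrightarrow> exhaust m \<subseteq> exhaust n"
  by (auto simp: exhaust_def)

lemma finite_subset_exhaust:
  assumes "finite F" and "F \<subseteq> \<S>"
  obtains n where "F \<subseteq> exhaust n"
proof -
  have "F \<subseteq> exhaust (Suc (Max (to_nat_on \<S> ` F)))"
    using assms by (auto simp: exhaust_def less_Suc_eq_le)
  then show ?thesis using that by blast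
qed

lemma filterlim_exhaust: "filterlim exhaust (finite_subsets_at_top \<S>) sequentially"
  unfolding filterlim_iff
proof (intro allI impI)
  fix P assume "eventually P (finite_subsets_at_top \<S>)"
  then obtain F where F: "finite F \<and> F \<subseteq> \<S> \<and> (\<forall>G. finite G \<and> F \<subseteq> G \<and> G \<subseteq> \<S> \<longrightarrow> P G)"
    unfolding eventually_finite_subsets_at_top by (elim exE)
  obtain n where n: "F \<subseteq> exhaust n" by (rule finite_subset_exhaust[of F]) (use F in simp_all)
  have "P (exhaust m)" if "n \<le> m" for m
    using F finite_exhaust[of m] exhaust_subset[of m] order_trans[OF n exhaust_mono[OF that]] by simp
  then show "\<forall>\<^sub>F m in sequentially. P (exhaust m)"
    unfolding eventually_sequentially by (intro exI[of _ n] allI impI)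
qed

text \<open>The \<open>p\<close>-th power of the pointwise sum of norms outside \<open>D\<close>,
  possibly infinite. It decides absolute convergence when \<open>D\<close> is empty and dominates
  the error of the partial sum over a finite \<open>D\<close>.\<close>

definition tail_sup ::
    "real \<Rightarrow> ((real^'n) set \<Rightarrow> real^'n \<Rightarrow> 'e::real_normed_vector) \<Rightarrow> (real^'n) set set \<Rightarrow> real^'n \<Rightarrow> ennreal" where
  "tail_sup p f D x = (SUP n. ennreal ((\<Sum>S\<in>exhaust n - D. norm (f S x)) powr p))"

lemma measurable_tail_sup:
  assumes f: "adapted \<mu> \<S> f"
  shows "tail_sup p f D \<in> borel_measurable \<mu>"
proof -
  have "(\<lambda>x. \<Sum>S\<in>exhaust n - D. norm (f S x)) \<in> borel_measurable \<mu>" for n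
    using adapted_measurable[OF f] exhaust_subset
    by (intro borel_measurable_sum borel_measurable_norm_strongly_measurable) auto
  note [measurable] = this
  show ?thesis unfolding tail_sup_def[abs_def] by measurable
qed

text \<open>Monotone convergence reduces this to the finite collections
  \<open>exhaust n - D\<close>, on which the estimate with norms inside the power holds with a
  constant independent of \<open>n\<close>.\<close>

lemma nn_integral_tail_sup_le:
  fixes f :: "(real^'n) set \<Rightarrow> real^'n \<Rightarrow> 'e::real_normed_vector"
  assumes p: "1 \<le> p" and f: "adapted \<mu> \<S> f"
    and c: "\<And>F. finite F \<Longrightarrow> F \<subseteq> \<S> - D \<Longrightarrow> (\<Sum>S\<in>F. \<integral>\<^sup>+x. ennreal (norm (f S x) powr p) \<partial>\<mu>) \<le> c"
  shows "(\<integral>\<^sup>+x. tail_sup p f D x \<partial>\<mu>) \<le> ennreal ((3 * p) powr p) * c"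
proof -
  let ?s = "\<lambda>n x. \<Sum>S\<in>exhaust n - D. norm (f S x)"
  have [measurable]: "?s n \<in> borel_measurable \<mu>" for n
    using adapted_measurable[OF f] exhaust_subset
    by (intro borel_measurable_sum borel_measurable_norm_strongly_measurable) auto
  have "(\<integral>\<^sup>+x. tail_sup p f D x \<partial>\<mu>) = (SUP n. \<integral>\<^sup>+x. ennreal (?s n x powr p) \<partial>\<mu>)"
    unfolding tail_sup_def
  proof (rule nn_integral_monotone_convergence_SUP)
    show "incseq (\<lambda>n x. ennreal (?s n x powr p))"
    proof (intro incseq_SucI le_funI ennreal_leI powr_mono2)
      show "?s n x \<le> ?s (Suc n) x" for n x
        using finite_exhaust exhaust_mono[of n "Suc n"] by (intro sum_mono2) auto
    qed (use p in \<open>auto intro: sum_nonneg\<close>)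
  qed measurable
  also have "\<dots> \<le> ennreal ((3 * p) powr p) * c"
  proof (intro SUP_least)
    fix n
    have sub: "exhaust n - D \<subseteq> \<S>" using exhaust_subset by auto
    interpret F: sparse_dyadic \<mu> "exhaust n - D" by (rule subcollection[OF sub])
    have "(\<integral>\<^sup>+x. ennreal (?s n x powr p) \<partial>\<mu>)
        \<le> ennreal ((3 * p) powr p) * (\<Sum>S\<in>exhaust n - D. \<integral>\<^sup>+x. ennreal (norm (f S x) powr p) \<partial>\<mu>)"
      using finite_exhaust by (intro F.nn_integral_sum_norm_powr_le p adapted_subcollection[OF sub f]) auto
    also have "\<dots> \<le> ennreal ((3 * p) powr p) * c"
      using finite_exhaust exhaust_subset by (intro mult_left_mono c) auto
    finally show "(\<integral>\<^sup>+x. ennreal (?s n x powr p) \<partial>\<mu>) \<le> ennreal ((3 * p) powr p) * c" .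
  qed
  finally show ?thesis .
qed

lemma summable_if_tail_sup_finite:
  fixes f :: "(real^'n) set \<Rightarrow> real^'n \<Rightarrow> 'e::banach"
  assumes p: "1 \<le> p" and fin: "tail_sup p f {} x < top"
  shows "(\<lambda>S. f S x) summable_on \<S>"
proof -
  obtain M where M: "tail_sup p f {} x = ennreal M" "0 \<le> M"
    using fin by (cases "tail_sup p f {} x") auto
  have bound: "(\<Sum>S\<in>F. norm (f S x)) \<le> M powr (1 / p)" if F: "finite F" "F \<subseteq> \<S>" for F
  proof -
    obtain n where n: "F \<subseteq> exhaust n" using F by (rule finite_subset_exhaust)
    have "(\<Sum>S\<in>F. norm (f S x)) \<le> (\<Sum>S\<in>exhaust n. norm (f S x))"
      using n finite_exhaust by (intro sum_mono2) auto
    also have "\<dots> \<le> M powr (1 / p)"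
    proof (rule powr_le_imp_le)
      have "ennreal ((\<Sum>S\<in>exhaust n - {}. norm (f S x)) powr p) \<le> tail_sup p f {} x"
        unfolding tail_sup_def by (rule SUP_upper) simp
      then show "(\<Sum>S\<in>exhaust n. norm (f S x)) powr p \<le> M" using M by simp
    qed (use p in \<open>auto intro: sum_nonneg\<close>)
    finally show ?thesis .
  qed
  have "(\<lambda>S. norm (f S x)) summable_on \<S>"
    using bound by (intro nonneg_bdd_above_summable_on) (auto simp: bdd_above_def)
  then show ?thesis by (rule abs_summable_summable)
qed

text \<open>Once \<open>exhaust n\<close> contains \<open>D\<close>, the difference of the two
  partial sums is a sum over \<open>exhaust n - D\<close>; the bound is uniform in \<open>n\<close>
  and survives the limit.\<close>

lemma diff_le_tail_sup:
  fixes f :: "(real^'n) set \<Rightarrow> real^'n \<Rightarrow> 'e::real_normed_vector"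
  assumes p: "1 \<le> p" and lim: "(\<lambda>n. \<Sum>S\<in>exhaust n. f S x) \<longlonglongrightarrow> y" and D: "finite D" "D \<subseteq> \<S>"
  shows "ennreal (norm ((\<Sum>S\<in>D. f S x) - y) powr p) \<le> tail_sup p f D x"
proof (rule tendsto_upperbound)
  let ?d = "\<lambda>n. norm ((\<Sum>S\<in>D. f S x) - (\<Sum>S\<in>exhaust n. f S x))"
  show "(\<lambda>n. ennreal (?d n powr p)) \<longlonglongrightarrow> ennreal (norm ((\<Sum>S\<in>D. f S x) - y) powr p)"
    using p by (intro tendsto_ennrealI tendsto_powr' tendsto_norm tendsto_diff tendsto_const lim) auto
  obtain n0 where n0: "D \<subseteq> exhaust n0" using D by (rule finite_subset_exhaust)
  have "ennreal (?d n powr p) \<le> tail_sup p f D x" if "n0 \<le> n" for n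
  proof -
    have "D \<subseteq> exhaust n" using n0 exhaust_mono[OF that] by blast
    then have "?d n = norm (\<Sum>S\<in>exhaust n - D. f S x)"
      using finite_exhaust by (simp add: sum_diff norm_minus_commute)
    also have "\<dots> \<le> (\<Sum>S\<in>exhaust n - D. norm (f S x))" by (rule norm_sum)
    finally have "ennreal (?d n powr p) \<le> ennreal ((\<Sum>S\<in>exhaust n - D. norm (f S x)) powr p)"
      using p by (intro ennreal_leI powr_mono2) auto
    also have "\<dots> \<le> tail_sup p f D x" unfolding tail_sup_def by (rule SUP_upper) simp
    finally show ?thesis .
  qed
  then show "\<forall>\<^sub>F n in sequentially. ennreal (?d n powr p) \<le> tail_sup p f D x"
    by (auto simp: eventually_sequentially)
qed simp

text \<open>The estimate for \<open>tail_sup\<close> with empty \<open>D\<close> gives absolute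
  convergence almost everywhere. The same estimate outside a large finite subcollection makes the
  error small in norm, because the norm powers have small tails.\<close>

lemma ex_Lp_has_sum:
  fixes f :: "(real^'n) set \<Rightarrow> real^'n \<Rightarrow> 'e::banach"
  assumes p: "1 \<le> p" and f: "adapted \<mu> \<S> f" and fin: "lp_Lp_norm \<mu> p \<S> f < \<infinity>"
  shows "\<exists>g. Lp_has_sum \<mu> p \<S> f g \<and> (AE x in \<mu>. ((\<lambda>S. f S x) has_sum g x) \<S>)"
proof -
  let ?N = "\<lambda>S. \<integral>\<^sup>+x. ennreal (norm (f S x) powr p) \<partial>\<mu>"
  have total: "(\<Sum>\<^sub>\<infinity>S\<in>\<S>. ?N S) < top"
    using fin p by (simp add: lp_Lp_norm_def epowr_less_top_iff epowr_Lp_norm)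
  define A where "A = {x. tail_sup p f {} x < top}"
  \<comment> \<open>The value 0 off \<open>A\<close> makes \<open>g\<close> the limit at every point
    of the partial sums cut off to \<open>A\<close>, as strong measurability demands.\<close>
  define g where "g x = (if x \<in> A then \<Sum>\<^sub>\<infinity>S\<in>\<S>. f S x else 0)" for x
  note tail_meas [measurable] = measurable_tail_sup[OF f]
  have A: "A \<in> sets \<mu>"
  proof -
    have "{x \<in> space \<mu>. tail_sup p f {} x < top} \<in> sets \<mu>" by measurable
    then show ?thesis by (simp add: A_def)
  qed
  have "(\<integral>\<^sup>+x. tail_sup p f {} x \<partial>\<mu>) \<le> ennreal ((3 * p) powr p) * (\<Sum>\<^sub>\<infinity>S\<in>\<S>. ?N S)"
    using infsum_ennreal_le_iff[of ?N \<S> "\<Sum>\<^sub>\<infinity>S\<in>\<S>. ?N S"]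
    by (intro nn_integral_tail_sup_le p f) auto
  also have "\<dots> < top" using total by (simp add: ennreal_mult_less_top)
  finally have "AE x in \<mu>. tail_sup p f {} x \<noteq> \<infinity>"
    by (intro nn_integral_PInf_AE tail_meas) simp
  then have AE_A: "AE x in \<mu>. x \<in> A" by (simp add: A_def less_top)
  have has_sum: "((\<lambda>S. f S x) has_sum g x) \<S>" if "x \<in> A" for x
    using summable_if_tail_sup_finite[OF p, of f x] that by (simp add: A_def g_def has_sum_infsum)
  have lim: "(\<lambda>n. \<Sum>S\<in>exhaust n. f S x) \<longlonglongrightarrow> g x" if "x \<in> A" for x
    using filterlim_compose[OF has_sum[OF that, unfolded has_sum_def] filterlim_exhaust] .
  have gm: "strongly_measurable \<mu> g"
  proof (rule strongly_measurable_LIMSEQ)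
    show "strongly_measurable \<mu> (\<lambda>x. indicator A x *\<^sub>R (\<Sum>S\<in>exhaust n. f S x))" for n
      using adapted_measurable[OF f] exhaust_subset
      by (intro strongly_measurable_indicator_scaleR A strongly_measurable_sum) auto
    show "(\<lambda>n. indicator A x *\<^sub>R (\<Sum>S\<in>exhaust n. f S x)) \<longlonglongrightarrow> g x" for x
      using lim[of x] by (cases "x \<in> A") (auto simp: g_def)
  qed
  have dist: "(\<integral>\<^sup>+x. ennreal (norm ((\<Sum>S\<in>D. f S x) - g x) powr p) \<partial>\<mu>) \<le> (\<integral>\<^sup>+x. tail_sup p f D x \<partial>\<mu>)"
    if "finite D" "D \<subseteq> \<S>" for D
    by (rule nn_integral_mono_AE) (use AE_A in eventually_elim, rule diff_le_tail_sup[OF p lim that])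
  have "((\<lambda>F. Lp_norm \<mu> p (\<lambda>x. (\<Sum>S\<in>F. f S x) - g x)) \<longlongrightarrow> 0) (finite_subsets_at_top \<S>)"
  proof (rule order_tendstoI)
    fix a :: ennreal assume "0 < a"
    obtain e where e: "0 < e" "ennreal e < a"
    proof (cases a)
      case (real r)
      then show ?thesis using \<open>0 < a\<close> that[of "r / 2"] by (simp add: ennreal_less_iff)
    qed (use that[of 1] in simp)
    \<comment> \<open>This tail size compensates the factor \<open>(3 * p) powr p\<close> in the
      estimate of \<open>tail_sup\<close>, leaving \<open>e powr p\<close>.\<close>
    have e': "0 < (e / (3 * p)) powr p" using e p by simp
    obtain F0 where F0: "finite F0" "F0 \<subseteq> \<S>"
      "\<And>F. finite F \<Longrightarrow> F \<subseteq> \<S> - F0 \<Longrightarrow> sum ?N F \<le> ennreal ((e / (3 * p)) powr p)"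
      using ennreal_sum_tail[OF total e'] by blast
    show "\<forall>\<^sub>F F in finite_subsets_at_top \<S>. Lp_norm \<mu> p (\<lambda>x. (\<Sum>S\<in>F. f S x) - g x) < a"
    proof (rule eventually_finite_supersets[OF F0(1,2)])
      fix F assume F: "finite F" "F0 \<subseteq> F" "F \<subseteq> \<S>"
      have "(\<integral>\<^sup>+x. ennreal (norm ((\<Sum>S\<in>F. f S x) - g x) powr p) \<partial>\<mu>)
          \<le> (\<integral>\<^sup>+x. tail_sup p f F x \<partial>\<mu>)" by (rule dist[OF F(1,3)])
      also have "\<dots> \<le> ennreal ((3 * p) powr p) * ennreal ((e / (3 * p)) powr p)"
        using F by (intro nn_integral_tail_sup_le p f F0(3)) auto
      also have "\<dots> = epowr (ennreal e) p"
      proof -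
        have "(3 * p) powr p * (e / (3 * p)) powr p = ((3 * p) * (e / (3 * p))) powr p"
          by (rule powr_mult[symmetric])
        also have "(3 * p) * (e / (3 * p)) = e" using p by simp
        finally show ?thesis using e by (simp add: epowr_ennreal ennreal_mult[symmetric])
      qed
      finally have "Lp_norm \<mu> p (\<lambda>x. (\<Sum>S\<in>F. f S x) - g x) \<le> ennreal e"
        using p by (subst Lp_norm_le_iff) auto
      then show "Lp_norm \<mu> p (\<lambda>x. (\<Sum>S\<in>F. f S x) - g x) < a" using e(2) by (rule order_le_less_trans)
    qed
  qed simp
  then have "Lp_has_sum \<mu> p \<S> f g" using gm by (simp add: Lp_has_sum_def)
  moreover have "AE x in \<mu>. ((\<lambda>S. f S x) has_sum g x) \<S>"
    using AE_A by eventually_elim (rule has_sum)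
  ultimately show ?thesis by blast
qed

end

section \<open>Failure of the reverse estimate\<close>

text \<open>Two nested cubes carry the opposite functions equal to \<open>v\<close> and
  \<open>- v\<close> on the smaller cube and 0 elsewhere. Their sum is zero while each has positive
  norm, so every constant fails, even \<open>\<infinity>\<close>, as
  \<open>\<infinity> * 0 = 0\<close>.\<close>

lemma reverse_estimate_fails:
  fixes v :: "'e::real_normed_vector" and C :: ennreal
  assumes v: "v \<noteq> 0" and p: "1 \<le> p"
  shows "\<exists>(\<nu> :: (real^'n::finite) measure) \<T> (f :: (real^'n) set \<Rightarrow> real^'n \<Rightarrow> 'e) g.
    sets \<nu> = sets borel \<and> \<T> \<subseteq> dyadic_cubes \<and> sparse_collection \<nu> \<T> \<and> adapted \<nu> \<T> f \<and>
    Lp_has_sum \<nu> p \<T> f g \<and>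
    lp_Lp_norm \<nu> p \<T> f < \<infinity> \<and> \<not> lp_Lp_norm \<nu> p \<T> f \<le> C * Lp_norm \<nu> p g"
proof -
  define S :: "(real^'n) set" where "S = dyadic_cube 0 (\<lambda>_. 0)"
  define T :: "(real^'n) set" where "T = dyadic_cube 1 (\<lambda>_. 0)"
  define b :: "real^'n" where "b = (\<chi> i. 1 / 2)"
  define e where "e t = (if t then 0 else b)" for t
  \<comment> \<open>The image of the counting measure on \<open>bool\<close>: unit masses at the
    origin, which lies in \<open>T\<close>, and at \<open>b\<close>, which lies in
    \<open>S - T\<close>. Hence \<open>E_part\<close> of \<open>S\<close> carries exactly half of
    its mass.\<close>
  define \<nu> where "\<nu> = distr (count_space UNIV) borel e"
  define f where "f R x = (if R = S then indicator T x *\<^sub>R v else - (indicator T x *\<^sub>R v))" for R x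
  have mem: "0 \<in> S" "0 \<in> T" "b \<in> S" "b \<notin> T"
    by (auto simp: S_def T_def b_def dyadic_cube_def power_int_minus)
  have TS: "T \<subset> S"
    using mem dyadic_cube_subset[of 0 1 "0 :: real^'n" "\<lambda>_. 0" "\<lambda>_. 0"] unfolding S_def T_def by auto
  have "T \<noteq> S" using TS by blast
  have cubes: "{S, T} \<subseteq> dyadic_cubes" by (auto simp: S_def T_def dyadic_cubes_def)
  have sets_\<nu>: "sets \<nu> = sets borel" by (simp add: \<nu>_def)
  have meas: "S \<in> sets \<nu>" "T \<in> sets \<nu>" using cubes borel_dyadic_cubes by (auto simp: sets_\<nu>)
  have nn: "(\<integral>\<^sup>+x. \<phi> x \<partial>\<nu>) = \<phi> 0 + \<phi> b" if "\<phi> \<in> borel_measurable \<nu>" for \<phi>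
    using that unfolding \<nu>_def
    by (subst nn_integral_distr) (auto simp: nn_integral_count_space_finite UNIV_bool e_def add.commute)
  have em: "emeasure \<nu> A = indicator A 0 + indicator A b" if "A \<in> sets \<nu>" for A
    using nn[of "indicator A"] that by simp
  have ch: "ch {S, T} S = {T}" "ch {S, T} T = {}" using TS by (auto simp: ch_def)
  have "sparse_collection \<nu> {S, T}"
  proof -
    have "emeasure \<nu> S / 2 \<le> emeasure \<nu> (S - T)"
      using meas mem by (intro divide_le_posI_ennreal) (auto simp: em one_add_one)
    moreover have "emeasure \<nu> T / 2 \<le> emeasure \<nu> T"
      using meas mem by (intro divide_le_posI_ennreal) (auto simp: em)
    ultimately show ?thesis by (auto simp: sparse_collection_def E_part_def ch)
  qed
  moreover have fm: "strongly_measurable \<nu> (f R)" for R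
    using strongly_measurable_indicator_scaleR[OF meas(2) strongly_measurable_const, of v]
      strongly_measurable_indicator_scaleR[OF meas(2) strongly_measurable_const, of "- v"]
    by (cases "R = S") (simp_all add: f_def[abs_def])
  moreover have "adapted \<nu> {S, T} f"
  proof -
    have "f S constant_on T" by (auto simp: constant_on_def f_def)
    then show ?thesis using fm TS by (auto simp: adapted_def ch f_def indicator_def)
  qed
  moreover have "Lp_has_sum \<nu> p {S, T} f (\<lambda>x. 0)"
  proof -
    have "Lp_norm \<nu> p (\<lambda>x. (\<Sum>R\<in>{S, T}. f R x) - 0) = 0"
      using \<open>T \<noteq> S\<close> by (simp add: f_def Lp_norm_def)
    \<comment> \<open>For a finite index set the filter of finite subsets is principal at the whole
      set, so only the full sum matters.\<close>
    then have "\<forall>\<^sub>F F in principal {{S, T}}. Lp_norm \<nu> p (\<lambda>x. (\<Sum>R\<in>F. f R x) - 0) = 0"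
      unfolding eventually_principal by blast
    then show ?thesis
      unfolding Lp_has_sum_def by (simp add: finite_subsets_at_top_finite tendsto_eventually)
  qed
  moreover have int: "(\<integral>\<^sup>+x. ennreal (norm (f R x) powr p) \<partial>\<nu>) = ennreal (norm v powr p)" for R
  proof -
    have "(\<lambda>x. ennreal (norm (f R x) powr p)) \<in> borel_measurable \<nu>"
      using measurable_norm_powr[OF fm] by simp
    from nn[OF this] show ?thesis using mem by (simp add: f_def)
  qed
  moreover have "lp_Lp_norm \<nu> p {S, T} f < \<infinity>"
    using p by (simp add: lp_Lp_norm_def epowr_less_top_iff epowr_Lp_norm int infsum_finite
        ennreal_mult_less_top of_nat_less_top)
  moreover have "\<not> lp_Lp_norm \<nu> p {S, T} f \<le> C * Lp_norm \<nu> p (\<lambda>x. 0 :: 'e)"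
  proof
    assume "lp_Lp_norm \<nu> p {S, T} f \<le> C * Lp_norm \<nu> p (\<lambda>x. 0 :: 'e)"
    then have "lp_Lp_norm \<nu> p {S, T} f \<le> 0" by (simp add: Lp_norm_def)
    then have "(\<Sum>R\<in>{T}. \<integral>\<^sup>+x. ennreal (norm (f R x) powr p) \<partial>\<nu>) \<le> epowr 0 p"
      using p by (subst (asm) lp_Lp_norm_le_iff) auto
    then show False using v by (simp add: int ennreal_eq_0_iff)
  qed
  ultimately show ?thesis using cubes sets_\<nu> by blast
qed

text \<open>The estimates quantify over every limit \<open>g\<close>, which is determined only up to
  null sets; the existence claim ensures that they are not vacuous when the mixed norm is finite.
  The counterexample asks for a nonzero vector because all norms vanish in the zero space.\<close>

theorem lemma2p7:
  fixes \<mu> :: "(real^'n::finite) measure"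
    and p :: real
    and \<S> :: "(real^'n::finite) set set"
  assumes borel: "sets \<mu> = sets borel"
    and p: "1 \<le> p"
    and dyadic: "\<S> \<subseteq> dyadic_cubes"
    and sparse: "sparse_collection \<mu> \<S>"
  shows
    "(\<forall>f :: (real^'n) set \<Rightarrow> real^'n \<Rightarrow> 'e::banach. adapted \<mu> \<S> f \<longrightarrow>
        (lp_Lp_norm \<mu> p \<S> f < \<infinity> \<longrightarrow>
           (\<exists>g. Lp_has_sum \<mu> p \<S> f g \<and> (AE x in \<mu>. ((\<lambda>S. f S x) has_sum g x) \<S>))) \<and>
        (\<forall>g. Lp_has_sum \<mu> p \<S> f g \<longrightarrow>
           Lp_norm \<mu> p g \<le> 3 * ennreal p * lp_Lp_norm \<mu> p \<S> f))
     \<and>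
     (\<forall>f :: (real^'n) set \<Rightarrow> real^'n \<Rightarrow> 'e. adapted \<mu> \<S> f \<longrightarrow>
        (\<forall>S\<in>\<S>. has_strong_integral \<mu> (\<lambda>x. indicator S x *\<^sub>R f S x) 0) \<longrightarrow>
        (\<forall>g. Lp_has_sum \<mu> p \<S> f g \<longrightarrow>
           lp_Lp_norm \<mu> p \<S> f \<le> 6 * conj_exponent p * Lp_norm \<mu> p g))
     \<and>
     (\<forall>f :: (real^'n) set \<Rightarrow> real^'n \<Rightarrow> real. adapted \<mu> \<S> f \<longrightarrow>
        (\<forall>S\<in>\<S>. \<forall>x. 0 \<le> f S x) \<longrightarrow>
        (\<forall>g. Lp_has_sum \<mu> p \<S> f g \<longrightarrow>
           lp_Lp_norm \<mu> p \<S> f \<le> 6 * conj_exponent p * Lp_norm \<mu> p g))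
     \<and>
     ((\<exists>v :: 'e. v \<noteq> 0) \<longrightarrow>
        (\<forall>C :: ennreal.
           \<exists>(\<nu> :: (real^'n) measure) \<T> (f :: (real^'n) set \<Rightarrow> real^'n \<Rightarrow> 'e) g.
             sets \<nu> = sets borel \<and> \<T> \<subseteq> dyadic_cubes \<and> sparse_collection \<nu> \<T> \<and> adapted \<nu> \<T> f \<and>
             Lp_has_sum \<nu> p \<T> f g \<and>
             lp_Lp_norm \<nu> p \<T> f < \<infinity> \<and> \<not> lp_Lp_norm \<nu> p \<T> f \<le> C * Lp_norm \<nu> p g))"
proof -
  interpret sparse_dyadic \<mu> \<S> by unfold_locales (fact borel dyadic sparse)+
  show ?thesis
  proof (intro conjI allI impI)
    fix f :: "(real^'n) set \<Rightarrow> real^'n \<Rightarrow> 'e" and g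
    assume f: "adapted \<mu> \<S> f"
    show "\<exists>g. Lp_has_sum \<mu> p \<S> f g \<and> (AE x in \<mu>. ((\<lambda>S. f S x) has_sum g x) \<S>)"
      if "lp_Lp_norm \<mu> p \<S> f < \<infinity>"
      using p f that by (rule ex_Lp_has_sum)
    assume g: "Lp_has_sum \<mu> p \<S> f g"
    show "Lp_norm \<mu> p g \<le> 3 * ennreal p * lp_Lp_norm \<mu> p \<S> f"
      using p f g by (rule forward_estimate)
    assume mean: "\<forall>S\<in>\<S>. has_strong_integral \<mu> (\<lambda>x. indicator S x *\<^sub>R f S x) 0"
    show "lp_Lp_norm \<mu> p \<S> f \<le> 6 * conj_exponent p * Lp_norm \<mu> p g"
    proof (rule reverse_estimate_mean_zero[OF p f g])
      fix S assume S: "S \<in> \<S>"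
      have "(\<lambda>x. indicator S x *\<^sub>R f S x) = f S"
        using adapted_outside[OF f S] by (auto simp: indicator_def)
      then show "has_strong_integral \<mu> (f S) 0" using mean S by metis
    qed
  next
    fix f :: "(real^'n) set \<Rightarrow> real^'n \<Rightarrow> real" and g
    assume "adapted \<mu> \<S> f" "\<forall>S\<in>\<S>. \<forall>x. 0 \<le> f S x" "Lp_has_sum \<mu> p \<S> f g"
    then show "lp_Lp_norm \<mu> p \<S> f \<le> 6 * conj_exponent p * Lp_norm \<mu> p g"
      by (intro reverse_estimate_nonneg p) auto
  next
    fix C :: ennreal
    assume "\<exists>v :: 'e. v \<noteq> 0"
    then obtain v :: 'e where "v \<noteq> 0" by blast
    then show "\<exists>(\<nu> :: (real^'n) measure) \<T> (f :: (real^'n) set \<Rightarrow> real^'n \<Rightarrow> 'e) g.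
        sets \<nu> = sets borel \<and> \<T> \<subseteq> dyadic_cubes \<and> sparse_collection \<nu> \<T> \<and> adapted \<nu> \<T> f \<and>
        Lp_has_sum \<nu> p \<T> f g \<and>
        lp_Lp_norm \<nu> p \<T> f < \<infinity> \<and> \<not> lp_Lp_norm \<nu> p \<T> f \<le> C * Lp_norm \<nu> p g"
      using p by (rule reverse_estimate_fails)
  qed
qed

end
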